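(* Let $D$ be a Douglas algebra, with character space $M(D)$ and Shilov boundary $\partial D\subseteq M(D)$. Then $\partial D$ is the largest set on which $D$ is pointwise regular; that is, $D$ is pointwise regular on $\partial D$, and every set $X\subseteq M(D)$ on which $D$ is pointwise regular satisfies $X\subseteq \partial D$.
   Context: Let $\mathbb T$ be the unit circle, $L^\infty(\mathbb T)$ the algebra of (equivalence classes of) essentially bounded measurable functions on $\mathbb T$ with the essential supremum norm, and $H^\infty(\mathbb T)$ the closed subalgebra of those functions in $L^\infty(\mathbb T)$ whose negative Fourier coefficients vanish. A Douglas algebra is a closed subalgebra of $L^\infty(\mathbb T)$ that strictly contains $H^\infty(\mathbb T)$. For a commutative unital semisimple Banach algebra $A$, $M(A)$ denotes its character space (all non-zero multiplicative linear functionals) with the Gelfand (weak-$*$) topology, and elements $f\in A$ are identified with their Gelfand transforms, i.e. with continuous functions on $M(A)$. The Shilov boundary $\partial A$ is the smallest closed subset of $M(A)$ on which every $f\in A$ attains its maximum modulus. For $f\in A$, the support of $f$ is $\operatorname{supp} f=\overline{\{x\in M(A): f(x)\neq 0\}}$. A point $x\in M(A)$ is a regularity point of type one for $A$ if for every neighborhood $V$ of $x$ in $M(A)$ there is $f\in A$ with $f(x)=1$ and $\operatorname{supp} f\subseteq V$. For $X\subseteq M(A)$, $A$ is pointwise regular on $X$ if every $x\in X$ is a regularity point of type one for $A$. *)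

theory Defs
  imports "HOL-Probability.Probability"
begin

section \<open>Commutative unital complex normed algebras\<close>

class complex_normed_comm_algebra_1 = comm_ring_1 + real_normed_algebra_1 +
  fixes scaleC :: "complex \<Rightarrow> 'a \<Rightarrow> 'a"  (infixr \<open>*\<^sub>C\<close> 75)
  assumes scaleR_scaleC: "r *\<^sub>R x = complex_of_real r *\<^sub>C x"
    and scaleC_add_right: "a *\<^sub>C (x + y) = a *\<^sub>C x + a *\<^sub>C y"
    and scaleC_add_left: "(a + b) *\<^sub>C x = a *\<^sub>C x + b *\<^sub>C x"
    and scaleC_scaleC: "a *\<^sub>C (b *\<^sub>C x) = (a * b) *\<^sub>C x"
    and scaleC_one: "1 *\<^sub>C x = x"
    and mult_scaleC_left: "(a *\<^sub>C x) * y = a *\<^sub>C (x * y)"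
    and norm_scaleC: "norm (a *\<^sub>C x) = cmod a * norm x"

definition csubalgebra :: "'a::complex_normed_comm_algebra_1 set \<Rightarrow> bool" where
  "csubalgebra A \<longleftrightarrow> 0 \<in> A \<and> (\<forall>f\<in>A. \<forall>g\<in>A. f + g \<in> A \<and> f * g \<in> A) \<and> (\<forall>c. \<forall>f\<in>A. c *\<^sub>C f \<in> A)"

text \<open>
  The algebras whose character spaces are considered are subalgebras \<open>A\<close> of an ambient algebra
  given by a type. A character of \<open>A\<close> is a functional on \<open>A\<close> only; it is represented by
  the function that is \<^term>\<open>undefined\<close> outside \<open>A\<close>, so that different elements of
  \<^term>\<open>characters A\<close> differ on \<open>A\<close>. The value of the Gelfand transform of \<open>f\<close>
  at \<open>x\<close> is \<open>x f\<close>.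
\<close>

definition characters :: "'a::complex_normed_comm_algebra_1 set \<Rightarrow> ('a \<Rightarrow> complex) set" where
  "characters A = {x \<in> extensional A.
     (\<forall>f\<in>A. \<forall>g\<in>A. x (f + g) = x f + x g) \<and>
     (\<forall>c. \<forall>f\<in>A. x (c *\<^sub>C f) = c * x f) \<and>
     (\<forall>f\<in>A. \<forall>g\<in>A. x (f * g) = x f * x g) \<and>
     (\<exists>f\<in>A. x f \<noteq> 0)}"

text \<open>The weak-* topology is the topology of pointwise convergence on \<open>A\<close>.\<close>

definition gelfand_topology ::
    "'a::complex_normed_comm_algebra_1 set \<Rightarrow> ('a \<Rightarrow> complex) topology" where
  "gelfand_topology A = subtopology (product_topology (\<lambda>_. euclidean) A) (characters A)"

definition closed_boundary ::
    "'a::complex_normed_comm_algebra_1 set \<Rightarrow> ('a \<Rightarrow> complex) set \<Rightarrow> bool" where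
  "closed_boundary A S \<longleftrightarrow> closedin (gelfand_topology A) S \<and>
     (\<forall>f\<in>A. \<exists>x\<in>S. \<forall>y\<in>characters A. cmod (y f) \<le> cmod (x f))"

text \<open>The least element is taken with respect to inclusion of sets.\<close>

definition shilov_boundary ::
    "'a::complex_normed_comm_algebra_1 set \<Rightarrow> ('a \<Rightarrow> complex) set" where
  "shilov_boundary A = (LEAST S. closed_boundary A S)"

definition gelfand_support ::
    "'a::complex_normed_comm_algebra_1 set \<Rightarrow> 'a \<Rightarrow> ('a \<Rightarrow> complex) set" where
  "gelfand_support A f = gelfand_topology A closure_of {x \<in> characters A. x f \<noteq> 0}"

definition regularity_point_type_one ::
    "'a::complex_normed_comm_algebra_1 set \<Rightarrow> ('a \<Rightarrow> complex) \<Rightarrow> bool" where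
  "regularity_point_type_one A x \<longleftrightarrow> x \<in> characters A \<and>
     (\<forall>V \<subseteq> characters A. (\<exists>U. openin (gelfand_topology A) U \<and> x \<in> U \<and> U \<subseteq> V) \<longrightarrow>
        (\<exists>f\<in>A. x f = 1 \<and> gelfand_support A f \<subseteq> V))"

definition pointwise_regular_on ::
    "'a::complex_normed_comm_algebra_1 set \<Rightarrow> ('a \<Rightarrow> complex) set \<Rightarrow> bool" where
  "pointwise_regular_on A X \<longleftrightarrow>
     X \<subseteq> characters A \<and> (\<forall>x\<in>X. regularity_point_type_one A x)"

lemma topspace_gelfand_topology [simp]: "topspace (gelfand_topology A) = characters A"
  by (auto simp: gelfand_topology_def characters_def PiE_def)


section \<open>The algebra of essentially bounded functions on the unit circle\<close>

text \<open>
  Normalised arc length on the Borel sets of the circle. Every Lebesgue measurable function agrees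
  almost everywhere with a Borel one, so completing the measure would not change the equivalence
  classes below.
\<close>

definition circle_measure :: "complex measure" where
  "circle_measure =
     distr (uniform_measure lborel {0..2*pi}) (restrict_space borel (sphere 0 1)) cis"

lemma measurable_cis_circle [measurable]:
  "cis \<in> uniform_measure lborel {0..2*pi} \<rightarrow>\<^sub>M restrict_space borel (sphere 0 1)"
proof -
  have "cis \<in> borel \<rightarrow>\<^sub>M restrict_space borel (sphere 0 1)"
    by (intro measurable_restrict_space2 borel_measurable_continuous_onI continuous_on_cis) auto
  then show ?thesis by (simp add: measurable_def)
qed

lemma space_circle_measure: "space circle_measure = sphere 0 1"
  by (simp add: circle_measure_def space_restrict_space)

lemma sets_circle_measure: "sets circle_measure = sets (restrict_space borel (sphere 0 1))"
  by (simp add: circle_measure_def)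

lemma prob_space_circle_measure: "prob_space circle_measure"
  unfolding circle_measure_def
  by (intro prob_space.prob_space_distr prob_space_uniform_measure measurable_cis_circle) auto

definition ess_bounded :: "(complex \<Rightarrow> complex) \<Rightarrow> bool" where
  "ess_bounded f \<longleftrightarrow> f \<in> borel_measurable circle_measure \<and>
     (\<exists>C. AE z in circle_measure. cmod (f z) \<le> C)"

lemma ess_boundedD [measurable_dest]: "ess_bounded f \<Longrightarrow> f \<in> borel_measurable circle_measure"
  by (simp add: ess_bounded_def)

lemma ess_bounded_const: "ess_bounded (\<lambda>_. c)"
  by (auto simp: ess_bounded_def)

lemma ess_bounded_add:
  assumes "ess_bounded f" "ess_bounded g"
  shows "ess_bounded (\<lambda>z. f z + g z)"
proof -
  obtain C D where "AE z in circle_measure. cmod (f z) \<le> C" "AE z in circle_measure. cmod (g z) \<le> D"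
    using assms by (auto simp: ess_bounded_def)
  then have "AE z in circle_measure. cmod (f z + g z) \<le> C + D"
    by eventually_elim (rule norm_triangle_mono)
  then show ?thesis using assms by (auto simp: ess_bounded_def)
qed

lemma ess_bounded_mult:
  assumes "ess_bounded f" "ess_bounded g"
  shows "ess_bounded (\<lambda>z. f z * g z)"
proof -
  obtain C D where "AE z in circle_measure. cmod (f z) \<le> C" "AE z in circle_measure. cmod (g z) \<le> D"
    using assms by (auto simp: ess_bounded_def)
  then have "AE z in circle_measure. cmod (f z * g z) \<le> C * D"
  proof eventually_elim
    case (elim z)
    then show ?case
      using order_trans[OF norm_ge_zero[of "f z"], of C] by (auto simp: norm_mult intro!: mult_mono)
  qed
  then show ?thesis using assms by (auto simp: ess_bounded_def)
qed

lemma ess_bounded_uminus: "ess_bounded f \<Longrightarrow> ess_bounded (\<lambda>z. - f z)"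
  by (auto simp: ess_bounded_def)

lemma ess_bounded_diff: "ess_bounded f \<Longrightarrow> ess_bounded g \<Longrightarrow> ess_bounded (\<lambda>z. f z - g z)"
  using ess_bounded_add[of f "\<lambda>z. - g z"] ess_bounded_uminus[of g] by simp

definition ess_norm :: "(complex \<Rightarrow> complex) \<Rightarrow> real" where
  "ess_norm f = real_of_ereal (esssup circle_measure (\<lambda>z. ereal (cmod (f z))))"

lemma ess_norm_finite:
  assumes "ess_bounded f"
  shows "ereal (ess_norm f) = esssup circle_measure (\<lambda>z. ereal (cmod (f z)))"
    and "ess_norm f \<ge> 0"
proof -
  interpret prob_space circle_measure by (rule prob_space_circle_measure)
  have [measurable]: "f \<in> borel_measurable circle_measure" using assms by (rule ess_boundedD)
  obtain C where "AE z in circle_measure. cmod (f z) \<le> C"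
    using assms by (auto simp: ess_bounded_def)
  then have "esssup circle_measure (\<lambda>z. ereal (cmod (f z))) \<le> ereal C"
    by (intro esssup_I) auto
  moreover have "0 \<le> esssup circle_measure (\<lambda>z. ereal (cmod (f z)))"
  proof -
    have "(0::ereal) = esssup circle_measure (\<lambda>_. 0)"
      by (rule esssup_const[symmetric]) (simp add: emeasure_space_1)
    also have "\<dots> \<le> esssup circle_measure (\<lambda>z. ereal (cmod (f z)))"
      by (rule esssup_mono) auto
    finally show ?thesis .
  qed
  ultimately show "ereal (ess_norm f) = esssup circle_measure (\<lambda>z. ereal (cmod (f z)))"
    and "ess_norm f \<ge> 0"
    by (auto simp: ess_norm_def ereal_real real_of_ereal_pos)
qed

lemma ess_norm_AE:
  assumes "ess_bounded f"
  shows "AE z in circle_measure. cmod (f z) \<le> ess_norm f"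
  using esssup_AE[where M = circle_measure and f = "\<lambda>z. ereal (cmod (f z))"]
  unfolding ess_norm_finite(1)[OF assms, symmetric] by simp

lemma ess_norm_le:
  assumes "ess_bounded f" "AE z in circle_measure. cmod (f z) \<le> C"
  shows "ess_norm f \<le> C"
proof -
  have [measurable]: "f \<in> borel_measurable circle_measure" using assms(1) by (rule ess_boundedD)
  have "ereal (ess_norm f) \<le> ereal C"
    unfolding ess_norm_finite(1)[OF assms(1)] using assms(2) by (intro esssup_I) auto
  then show ?thesis by simp
qed

definition linfty_rel :: "(complex \<Rightarrow> complex) \<Rightarrow> (complex \<Rightarrow> complex) \<Rightarrow> bool" where
  "linfty_rel f g \<longleftrightarrow> ess_bounded f \<and> ess_bounded g \<and> (AE z in circle_measure. f z = g z)"

quotient_type linfty = "complex \<Rightarrow> complex" / partial: linfty_rel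
proof (rule part_equivpI)
  show "\<exists>f. linfty_rel f f"
    by (rule exI[of _ "\<lambda>_. 0"]) (simp add: linfty_rel_def ess_bounded_const)
  show "symp linfty_rel"
    by (auto simp: linfty_rel_def symp_def elim: eventually_mono)
  show "transp linfty_rel"
    by (auto simp: linfty_rel_def transp_def elim: eventually_elim2)
qed

instantiation linfty :: comm_ring_1
begin

lift_definition zero_linfty :: linfty is "\<lambda>_. 0"
  by (simp add: linfty_rel_def ess_bounded_const)

lift_definition one_linfty :: linfty is "\<lambda>_. 1"
  by (simp add: linfty_rel_def ess_bounded_const)

lift_definition plus_linfty :: "linfty \<Rightarrow> linfty \<Rightarrow> linfty" is "\<lambda>f g z. f z + g z"
  by (auto simp: linfty_rel_def ess_bounded_add elim: eventually_elim2)

lift_definition minus_linfty :: "linfty \<Rightarrow> linfty \<Rightarrow> linfty" is "\<lambda>f g z. f z - g z"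
  by (auto simp: linfty_rel_def ess_bounded_diff elim: eventually_elim2)

lift_definition uminus_linfty :: "linfty \<Rightarrow> linfty" is "\<lambda>f z. - f z"
  by (auto simp: linfty_rel_def ess_bounded_uminus)

lift_definition times_linfty :: "linfty \<Rightarrow> linfty \<Rightarrow> linfty" is "\<lambda>f g z. f z * g z"
  by (auto simp: linfty_rel_def ess_bounded_mult elim: eventually_elim2)

instance
proof
  interpret prob_space circle_measure by (rule prob_space_circle_measure)
  show "(0::linfty) \<noteq> 1"
    by transfer (auto simp: linfty_rel_def AE_False)
qed (transfer; auto simp: linfty_rel_def algebra_simps
       intro!: ess_bounded_add ess_bounded_mult ess_bounded_diff ess_bounded_uminus ess_bounded_const)+

end

instantiation linfty :: complex_normed_comm_algebra_1
begin

lift_definition scaleC_linfty :: "complex \<Rightarrow> linfty \<Rightarrow> linfty" is "\<lambda>c f z. c * f z"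
  by (auto simp: linfty_rel_def ess_bounded_mult ess_bounded_const)

definition scaleR_linfty :: "real \<Rightarrow> linfty \<Rightarrow> linfty" where
  "scaleR_linfty r f = scaleC (complex_of_real r) f"

lift_definition norm_linfty :: "linfty \<Rightarrow> real" is ess_norm
proof -
  fix f g assume *: "linfty_rel f g"
  then have [measurable]: "f \<in> borel_measurable circle_measure" "g \<in> borel_measurable circle_measure"
    by (auto simp: linfty_rel_def ess_boundedD)
  show "ess_norm f = ess_norm g"
    using * unfolding ess_norm_def linfty_rel_def
    by (intro arg_cong[where f=real_of_ereal] esssup_AE_cong) (auto elim: eventually_mono)
qed

definition dist_linfty :: "linfty \<Rightarrow> linfty \<Rightarrow> real" where
  "dist_linfty f g = norm (f - g)"

definition sgn_linfty :: "linfty \<Rightarrow> linfty" where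
  "sgn_linfty f = inverse (norm f) *\<^sub>R f"

definition uniformity_linfty :: "(linfty \<times> linfty) filter" where
  "uniformity_linfty = (INF e\<in>{0<..}. principal {(x, y). dist x y < e})"

definition open_linfty :: "linfty set \<Rightarrow> bool" where
  "open_linfty S = (\<forall>x\<in>S. \<forall>\<^sub>F (x', y) in uniformity. x' = x \<longrightarrow> y \<in> S)"

instance
proof
  interpret prob_space circle_measure by (rule prob_space_circle_measure)
  fix a b :: real and c d :: complex and f g :: linfty
  show scaleC_add_right: "c *\<^sub>C (f + g) = c *\<^sub>C f + c *\<^sub>C g"
    and scaleC_add_left: "(c + d) *\<^sub>C f = c *\<^sub>C f + d *\<^sub>C f"
    and scaleC_scaleC: "c *\<^sub>C (d *\<^sub>C f) = (c * d) *\<^sub>C f"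
    and scaleC_one: "1 *\<^sub>C f = f"
    and mult_scaleC_left: "(c *\<^sub>C f) * g = c *\<^sub>C (f * g)" for c d :: complex and f g :: linfty
    by (transfer; auto simp: linfty_rel_def algebra_simps
          intro!: ess_bounded_add ess_bounded_mult ess_bounded_const)+
  show norm_scaleC: "norm (c *\<^sub>C f) = cmod c * norm f" for c :: complex and f :: linfty
  proof (transfer fixing: c)
    fix f assume "linfty_rel f f"
    then have f: "ess_bounded f" by (simp add: linfty_rel_def)
    have le: "ess_norm (\<lambda>z. c * f z) \<le> cmod c * ess_norm f" if "ess_bounded f" for c f
    proof (rule ess_norm_le)
      show "AE z in circle_measure. cmod (c * f z) \<le> cmod c * ess_norm f"
        using ess_norm_AE[OF that] by eventually_elim (simp add: norm_mult mult_left_mono)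
    qed (intro ess_bounded_mult ess_bounded_const that)
    show "ess_norm (\<lambda>z. c * f z) = cmod c * ess_norm f"
    proof (cases "c = 0")
      case True
      then show ?thesis
        using le[OF f, of 0] ess_norm_finite(2)[OF ess_bounded_const[of 0]] by simp
    next
      case False
      have "ess_norm f \<le> cmod (inverse c) * ess_norm (\<lambda>z. c * f z)"
        using le[OF ess_bounded_mult[OF ess_bounded_const[of c] f], of "inverse c"] False
        by (simp add: mult.assoc[symmetric])
      then have "cmod c * ess_norm f \<le> ess_norm (\<lambda>z. c * f z)"
        using False by (simp add: norm_divide field_simps)
      with le[OF f, of c] show ?thesis by simp
    qed
  qed
  show "a *\<^sub>R f = complex_of_real a *\<^sub>C f" by (simp add: scaleR_linfty_def)
  show "a *\<^sub>R (f + g) = a *\<^sub>R f + a *\<^sub>R g" "(a + b) *\<^sub>R f = a *\<^sub>R f + b *\<^sub>R f"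
    "a *\<^sub>R b *\<^sub>R f = (a * b) *\<^sub>R f" "1 *\<^sub>R f = f" "a *\<^sub>R f * g = a *\<^sub>R (f * g)"
    by (simp_all add: scaleR_linfty_def scaleC_add_right scaleC_add_left scaleC_scaleC scaleC_one
        mult_scaleC_left)
  show "f * a *\<^sub>R g = a *\<^sub>R (f * g)"
    by (metis mult.commute mult_scaleC_left scaleR_linfty_def)
  show "norm (a *\<^sub>R f) = \<bar>a\<bar> * norm f"
    by (simp add: scaleR_linfty_def norm_scaleC)
  show "dist f g = norm (f - g)" by (simp add: dist_linfty_def)
  show "sgn f = inverse (norm f) *\<^sub>R f" by (simp add: sgn_linfty_def)
  show "(uniformity :: (linfty \<times> linfty) filter) = (INF e\<in>{0<..}. principal {(x, y). dist x y < e})"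
    by (simp add: uniformity_linfty_def)
  show "open S = (\<forall>x\<in>S. \<forall>\<^sub>F (x', y) in uniformity. x' = x \<longrightarrow> y \<in> S)" for S :: "linfty set"
    by (simp add: open_linfty_def)
  show "(norm f = 0) = (f = 0)"
  proof (transfer, rule iffI)
    fix f assume "linfty_rel f f" "ess_norm f = 0"
    then show "linfty_rel f (\<lambda>_. 0)"
      using ess_norm_AE[of f] by (auto simp: linfty_rel_def ess_bounded_const)
  next
    fix f assume "linfty_rel f (\<lambda>_. 0)"
    then have "ess_bounded f" "AE z in circle_measure. cmod (f z) \<le> 0"
      by (auto simp: linfty_rel_def)
    then show "ess_norm f = 0"
      using ess_norm_le[of f 0] ess_norm_finite(2)[of f] by simp
  qed
  show "norm (f + g) \<le> norm f + norm g"
  proof transfer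
    fix f g assume "linfty_rel f f" "linfty_rel g g"
    then have f: "ess_bounded f" and g: "ess_bounded g" by (auto simp: linfty_rel_def)
    show "ess_norm (\<lambda>z. f z + g z) \<le> ess_norm f + ess_norm g"
    proof (rule ess_norm_le)
      show "AE z in circle_measure. cmod (f z + g z) \<le> ess_norm f + ess_norm g"
        using ess_norm_AE[OF f] ess_norm_AE[OF g] by eventually_elim (rule norm_triangle_mono)
    qed (intro ess_bounded_add f g)
  qed
  show "norm (f * g) \<le> norm f * norm g"
  proof transfer
    fix f g assume "linfty_rel f f" "linfty_rel g g"
    then have f: "ess_bounded f" and g: "ess_bounded g" by (auto simp: linfty_rel_def)
    show "ess_norm (\<lambda>z. f z * g z) \<le> ess_norm f * ess_norm g"
    proof (rule ess_norm_le)
      show "AE z in circle_measure. cmod (f z * g z) \<le> ess_norm f * ess_norm g"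
        using ess_norm_AE[OF f] ess_norm_AE[OF g]
        by eventually_elim (auto simp: norm_mult ess_norm_finite(2)[OF f] intro!: mult_mono)
    qed (intro ess_bounded_mult f g)
  qed
  show "norm (1::linfty) = 1"
  proof transfer
    have "esssup circle_measure (\<lambda>_. ereal 1) = ereal 1"
      by (rule esssup_const) (simp add: emeasure_space_1)
    then show "ess_norm (\<lambda>_. 1) = 1" by (simp add: ess_norm_def)
  qed
qed

end


section \<open>Bounded analytic functions and Douglas algebras\<close>

lemma measurable_powi_circle [measurable]:
  "(\<lambda>z. z powi n) \<in> borel_measurable circle_measure"
proof -
  have "continuous_on (sphere 0 1) (\<lambda>z::complex. z powi n)"
    by (intro continuous_intros) auto
  then show ?thesis
    using borel_measurable_continuous_on_restrict
    by (simp add: measurable_cong_sets[OF sets_circle_measure refl])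
qed

lift_definition fourier_coeff :: "linfty \<Rightarrow> int \<Rightarrow> complex" is
  "\<lambda>f n. integral\<^sup>L circle_measure (\<lambda>z. f z * z powi (- n))"
proof (rule ext)
  fix f g :: "complex \<Rightarrow> complex" and n :: int
  assume *: "linfty_rel f g"
  then have [measurable]: "f \<in> borel_measurable circle_measure" "g \<in> borel_measurable circle_measure"
    by (auto simp: linfty_rel_def ess_boundedD)
  show "integral\<^sup>L circle_measure (\<lambda>z. f z * z powi (- n)) =
        integral\<^sup>L circle_measure (\<lambda>z. g z * z powi (- n))"
    using * by (intro integral_cong_AE) (auto simp: linfty_rel_def elim: eventually_mono)
qed

definition hinfty :: "linfty set" where
  "hinfty = {f. \<forall>n<0. fourier_coeff f n = 0}"

definition douglas_algebra :: "linfty set \<Rightarrow> bool" where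
  "douglas_algebra D \<longleftrightarrow> closed D \<and> csubalgebra D \<and> hinfty \<subset> D"

end

(* The Shilov boundary of D is the set of characters x with |x b| = 1 for all unimodular b in D.
   It contains the restrictions of the characters of L^infinity, hence is a closed boundary, and a
   type-one regularity point lies in every closed boundary; so everything reduces to showing that its
   points are regularity points of type one.

   The analytic input is a factorisation in the style of Axler: for every measurable E there is an
   inner function b with b * indicator E in D. For E of small measure an outer function exp G of
   modulus exp (n (2 indicator E - 1)) makes the inner part c of 1 + exp G close to 1 in L^1, while
   c * indicator E is uniformly close to an element of H^infinity. An arbitrary indicator agrees off
   a small set with a continuous function, which belongs to D because the conjugate of z does. The
   function b is an infinite product of such c.

   Given x, g in D and eta > 0, cover the range of g by discs and let E run through their preimages.
   The products of the b (1 - indicator E) vanish, so x (b * indicator E) is nonzero for one of the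
   discs, and the support of b * indicator E only contains characters y with y g close to x g. *)

theory Submission
  imports Defs "HOL-Computational_Algebra.Polynomial"
begin

section \<open>Integration on the circle\<close>

text \<open>Indicators would separate characters of \<open>L^\<infinity>\<close>, but they need not
  lie in \<open>D\<close>. A multiplier \<open>b\<close> brings them into \<open>D\<close> at the
  price of a factor \<open>x b\<close>, which a general character may send to 0; this is why the
  boundary is described by \<open>cmod (x b) = 1\<close>, a condition formulated inside
  \<open>D\<close>. The multiplier of a small set rests on \<open>exp G / (1 + exp G)\<close>, which
  is nearly 1 where \<open>exp G\<close> is huge and nearly 0 where it is tiny, and so imitates an
  indicator; dividing by \<open>1 + exp G\<close> costs only its inner part. Approximate multipliers
  would not do, because the product of the \<open>b (1 - indicator E)\<close> has to vanish exactly.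
  The infinite product is exact because each of its factors divides it, so it inherits the accuracy
  of all of them. Strictness of the inclusion enters through the conjugate of \<open>z\<close>. It
  is essential: \<open>H^\<infinity>\<close> has no zero divisors, hence no such multipliers for
  sets that are neither null nor of full measure. Analytic functions in the disc never occur.
  Bounded almost everywhere limits of polynomials take their place, and the mean over the circle
  plays the role of the value at 0.\<close>

interpretation circle: prob_space circle_measure
  by (rule prob_space_circle_measure)

lemma borel_measurable_circleI:
  "continuous_on (sphere 0 1) f \<Longrightarrow> f \<in> borel_measurable circle_measure"
  using borel_measurable_continuous_on_restrict
  by (simp add: measurable_cong_sets[OF sets_circle_measure refl])

lemma integral_circle_measure:
  fixes f :: "complex \<Rightarrow> complex"
  assumes [measurable]: "f \<in> borel_measurable circle_measure"
  shows "integral\<^sup>L circle_measure f =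
    (1 / (2 * pi)) *\<^sub>R (\<integral>t. indicator {0..2*pi} t *\<^sub>R f (cis t) \<partial>lborel)"
proof -
  have f [measurable]: "f \<in> borel_measurable (restrict_space borel (sphere 0 1))"
    using assms by (simp add: measurable_cong_sets[OF sets_circle_measure refl])
  have "integral\<^sup>L circle_measure f = (\<integral>t. f (cis t) \<partial>uniform_measure lborel {0..2*pi})"
    unfolding circle_measure_def by (rule integral_distr) auto
  also have "uniform_measure lborel {0..2*pi} =
      density lborel (\<lambda>t. ennreal (indicator {0..2*pi} t / (2*pi)))"
    unfolding uniform_measure_def
  proof (rule density_cong)
    show "AE t in lborel. indicator {0..2*pi} t / emeasure lborel {0..2*pi} =
        ennreal (indicator {0..2*pi} t / (2*pi))"
      by (intro AE_I2) (auto simp: indicator_def divide_ennreal[symmetric] simp del: ennreal_1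
        simp add: ennreal_1[symmetric])
  qed auto
  also have "(\<integral>t. f (cis t) \<partial>\<dots>) =
      (\<integral>t. (indicator {0..2*pi} t / (2*pi)) *\<^sub>R f (cis t) \<partial>lborel)"
  proof (rule integral_density)
    have "(\<lambda>t. f (cis t)) \<in> borel_measurable (uniform_measure lborel {0..2*pi})"
      by measurable
    then show "(\<lambda>t. f (cis t)) \<in> borel_measurable lborel"
      by (simp add: measurable_def)
  qed auto
  also have "\<dots> = (1 / (2 * pi)) *\<^sub>R (\<integral>t. indicator {0..2*pi} t *\<^sub>R f (cis t) \<partial>lborel)"
    by (subst integral_scaleR_right[symmetric]) (simp add: field_simps)
  finally show ?thesis .
qed

lemma integral_circle_power:
  assumes "k > 0"
  shows "integral\<^sup>L circle_measure (\<lambda>z. z ^ k) = 0"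
proof -
  have "(\<integral>t. indicator {0..2*pi} t *\<^sub>R (cis t ^ k) \<partial>lborel) =
      cis (real k * (2*pi)) / (\<i> * k) - cis (real k * 0) / (\<i> * k)"
  proof (rule integral_FTC_Icc)
    fix x
    have "((\<lambda>t. cis (real k * t) / (\<i> * k)) has_vector_derivative cis (real k * x)) (at x within {0..2*pi})"
      using assms
      by (auto intro!: derivative_eq_intros simp: has_vector_derivative_def divide_simps
            scaleR_conv_of_real fun_eq_iff complex_eq_iff)
    then show "((\<lambda>t. cis (real k * t) / (\<i> * k)) has_vector_derivative cis x ^ k) (at x within {0..2*pi})"
      by (simp only: Complex.DeMoivre)
  qed (auto intro!: continuous_intros)
  also have "cis (real k * (2*pi)) = 1"
    using cis_multiple_2pi[of "real k"] by (simp add: ac_simps)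
  finally show ?thesis
    by (subst integral_circle_measure) (auto intro!: borel_measurable_circleI continuous_intros)
qed

lemma integrable_circle_bounded:
  fixes f :: "complex \<Rightarrow> 'b::{banach, second_countable_topology}"
  assumes "f \<in> borel_measurable circle_measure" "AE z in circle_measure. norm (f z) \<le> C"
  shows "integrable circle_measure f"
  using assms by (intro circle.integrable_const_bound)

lemma AE_circleI: "(\<And>z. cmod z = 1 \<Longrightarrow> P z) \<Longrightarrow> AE z in circle_measure. P z"
  by (rule AE_I2) (simp add: space_circle_measure)

lemma measurable_poly [measurable]: "poly (q :: complex poly) \<in> borel_measurable circle_measure"
  by (rule borel_measurable_circleI) (intro continuous_intros)

lemma poly_bounded_circle:
  fixes q :: "complex poly"
  obtains C where "\<And>z. z \<in> sphere 0 1 \<Longrightarrow> cmod (poly q z) \<le> C"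
proof -
  have "bounded (poly q ` sphere 0 1)"
    by (intro compact_imp_bounded compact_continuous_image continuous_intros) auto
  then show ?thesis
    using that unfolding bounded_iff by blast
qed

lemma integrable_poly [intro, simp]: "integrable circle_measure (poly (q :: complex poly))"
proof -
  obtain C where "\<And>z. z \<in> sphere 0 1 \<Longrightarrow> cmod (poly q z) \<le> C"
    using poly_bounded_circle[of q] by blast
  then show ?thesis
    by (intro integrable_circle_bounded[of _ C] AE_I2) (auto simp: space_circle_measure)
qed

text \<open>The mean value property at the origin. Evaluation at 0 respects products and
  exponentials, and all later computations of means rest on that.\<close>

lemma integral_poly: "integral\<^sup>L circle_measure (poly q) = poly q (0::complex)"
proof -
  have [simp]: "integrable circle_measure (\<lambda>z::complex. z ^ k)" for k
    using integrable_poly[of "monom 1 k"] by (simp add: poly_monom[abs_def])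
  have "poly q = (\<lambda>z. \<Sum>k\<le>degree q. coeff q k * z ^ k)"
    by (simp add: fun_eq_iff poly_altdef)
  then have "integral\<^sup>L circle_measure (poly q) =
      (\<Sum>k\<le>degree q. coeff q k * integral\<^sup>L circle_measure (\<lambda>z. z ^ k))"
    by simp
  also have "\<dots> = (\<Sum>k\<in>{0}. coeff q k * integral\<^sup>L circle_measure (\<lambda>z. z ^ k))"
    by (rule sum.mono_neutral_right) (auto simp: integral_circle_power)
  also have "\<dots> = poly q 0" by (simp add: poly_0_coeff_0 circle.prob_space)
  finally show ?thesis .
qed

section \<open>Bounded limits of polynomials\<close>

text \<open>A working form of \<open>H^\<infinity>\<close> at the level of functions: Fejer means
  show that every bounded analytic boundary function is such a limit. Closure under products and
  suitable exponentials can be read off the polynomials.\<close>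

definition poly_limit :: "(complex \<Rightarrow> complex) \<Rightarrow> bool" where
  "poly_limit f \<longleftrightarrow> f \<in> borel_measurable circle_measure \<and>
     (\<exists>p C. (\<forall>n. \<forall>z\<in>sphere 0 1. cmod (poly (p n) z) \<le> C) \<and>
       (AE z in circle_measure. (\<lambda>n. poly (p n) z) \<longlonglongrightarrow> f z))"

lemma poly_limitE:
  assumes "poly_limit f"
  obtains p C where "\<And>n z. z \<in> sphere 0 1 \<Longrightarrow> cmod (poly (p n) z) \<le> C"
    "AE z in circle_measure. (\<lambda>n. poly (p n) z) \<longlonglongrightarrow> f z"
  using assms unfolding poly_limit_def by blast

lemma poly_limitI:
  assumes "f \<in> borel_measurable circle_measure"
    and "\<And>n z. z \<in> sphere 0 1 \<Longrightarrow> cmod (poly (p n) z) \<le> C"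
    and "AE z in circle_measure. (\<lambda>n. poly (p n) z) \<longlonglongrightarrow> f z"
  shows "poly_limit f"
  using assms unfolding poly_limit_def by blast

lemma poly_limit_measurable [measurable_dest]:
  "poly_limit f \<Longrightarrow> f \<in> borel_measurable circle_measure"
  by (simp add: poly_limit_def)

lemma AE_bounded_limit:
  fixes f :: "complex \<Rightarrow> complex"
  assumes "\<And>n. AE z in circle_measure. cmod (s n z) \<le> C"
    and "AE z in circle_measure. (\<lambda>n. s n z) \<longlonglongrightarrow> f z"
  shows "AE z in circle_measure. cmod (f z) \<le> C"
proof -
  have "AE z in circle_measure. \<forall>n. cmod (s n z) \<le> C"
    using assms(1) by (simp add: AE_all_countable)
  with assms(2) show ?thesis
  proof eventually_elim
    case (elim z)
    then show ?case
      using tendsto_norm[of "\<lambda>n. s n z" "f z" sequentially] Lim_bounded by blast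
  qed
qed

lemma poly_limit_ess_bounded:
  assumes "poly_limit f"
  shows "ess_bounded f"
proof -
  obtain p C where p: "\<And>n z. z \<in> sphere 0 1 \<Longrightarrow> cmod (poly (p n) z) \<le> C"
    and lim: "AE z in circle_measure. (\<lambda>n. poly (p n) z) \<longlonglongrightarrow> f z"
    using assms by (rule poly_limitE) blast
  have "AE z in circle_measure. cmod (f z) \<le> C"
    by (rule AE_bounded_limit[OF _ lim], rule AE_circleI, simp add: p)
  then show ?thesis
    using assms by (auto simp: ess_bounded_def poly_limit_def)
qed

lemma integral_bounded_limit:
  fixes f :: "complex \<Rightarrow> complex"
  assumes [measurable]: "f \<in> borel_measurable circle_measure"
    "\<And>n. s n \<in> borel_measurable circle_measure"
    and "\<And>n. AE z in circle_measure. cmod (s n z) \<le> C"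
    and "AE z in circle_measure. (\<lambda>n. s n z) \<longlonglongrightarrow> f z"
  shows "(\<lambda>n. integral\<^sup>L circle_measure (s n)) \<longlonglongrightarrow> integral\<^sup>L circle_measure f"
  using assms by (intro integral_dominated_convergence[where w = "\<lambda>_. C"]) auto

lemma poly_limit_integral:
  assumes "f \<in> borel_measurable circle_measure"
    and "\<And>n z. z \<in> sphere 0 1 \<Longrightarrow> cmod (poly (p n) z) \<le> C"
    and "AE z in circle_measure. (\<lambda>n. poly (p n) z) \<longlonglongrightarrow> f z"
  shows "(\<lambda>n. poly (p n) 0) \<longlonglongrightarrow> integral\<^sup>L circle_measure f"
proof -
  have "(\<lambda>n. integral\<^sup>L circle_measure (poly (p n))) \<longlonglongrightarrow> integral\<^sup>L circle_measure f"
    using assms by (intro integral_bounded_limit[where C = C]) (auto intro: AE_circleI)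
  then show ?thesis by (simp add: integral_poly)
qed

lemma poly_limit_poly [intro, simp]: "poly_limit (poly q)"
proof -
  obtain C where "\<And>z. z \<in> sphere 0 1 \<Longrightarrow> cmod (poly q z) \<le> C"
    using poly_bounded_circle[of q] by blast
  then show ?thesis by (intro poly_limitI[of _ "\<lambda>_. q" C]) auto
qed

lemma poly_limit_const [intro, simp]: "poly_limit (\<lambda>_. c)"
proof -
  have "poly [:c:] = (\<lambda>_. c)" by (simp add: fun_eq_iff)
  then show ?thesis by (metis poly_limit_poly)
qed

lemma poly_limit_add:
  assumes "poly_limit f" "poly_limit g"
  shows "poly_limit (\<lambda>z. f z + g z)"
proof -
  obtain p C where p: "\<And>n z. z \<in> sphere 0 1 \<Longrightarrow> cmod (poly (p n) z) \<le> C"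
    "AE z in circle_measure. (\<lambda>n. poly (p n) z) \<longlonglongrightarrow> f z"
    using assms(1) by (rule poly_limitE) blast
  obtain q D where q: "\<And>n z. z \<in> sphere 0 1 \<Longrightarrow> cmod (poly (q n) z) \<le> D"
    "AE z in circle_measure. (\<lambda>n. poly (q n) z) \<longlonglongrightarrow> g z"
    using assms(2) by (rule poly_limitE) blast
  show ?thesis
  proof (rule poly_limitI[of _ "\<lambda>n. p n + q n" "C + D"])
    show "(\<lambda>z. f z + g z) \<in> borel_measurable circle_measure"
      using assms by measurable
    show "cmod (poly (p n + q n) z) \<le> C + D" if "z \<in> sphere 0 1" for n z
      using p(1)[OF that] q(1)[OF that] by (simp add: norm_triangle_mono)
    show "AE z in circle_measure. (\<lambda>n. poly (p n + q n) z) \<longlonglongrightarrow> f z + g z"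
      using p(2) q(2) by eventually_elim (simp add: tendsto_add)
  qed
qed

text \<open>The mean is multiplicative because on the approximating polynomials it is evaluation at
  0, and dominated convergence passes this to the limit.\<close>

lemma poly_limit_mult:
  assumes "poly_limit f" "poly_limit g"
  shows "poly_limit (\<lambda>z. f z * g z)"
    and "(LINT z|circle_measure. f z * g z) =
      integral\<^sup>L circle_measure f * integral\<^sup>L circle_measure g"
proof -
  obtain p C where p: "\<And>n z. z \<in> sphere 0 1 \<Longrightarrow> cmod (poly (p n) z) \<le> C"
    "AE z in circle_measure. (\<lambda>n. poly (p n) z) \<longlonglongrightarrow> f z"
    using assms(1) by (rule poly_limitE) blast
  obtain q D where q: "\<And>n z. z \<in> sphere 0 1 \<Longrightarrow> cmod (poly (q n) z) \<le> D"
    "AE z in circle_measure. (\<lambda>n. poly (q n) z) \<longlonglongrightarrow> g z"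
    using assms(2) by (rule poly_limitE) blast
  have m: "(\<lambda>z. f z * g z) \<in> borel_measurable circle_measure"
    using assms by measurable
  have b: "cmod (poly (p n * q n) z) \<le> C * D" if "z \<in> sphere 0 1" for n z
    using p(1)[OF that, of n] q(1)[OF that, of n] order_trans[OF norm_ge_zero p(1)[OF that, of n]]
    by (auto simp: norm_mult intro!: mult_mono)
  have l: "AE z in circle_measure. (\<lambda>n. poly (p n * q n) z) \<longlonglongrightarrow> f z * g z"
    using p(2) q(2) by eventually_elim (simp add: tendsto_mult)
  show "poly_limit (\<lambda>z. f z * g z)"
    by (rule poly_limitI[OF m b l])
  have "(\<lambda>n. poly (p n) 0 * poly (q n) 0) \<longlonglongrightarrow>
      integral\<^sup>L circle_measure f * integral\<^sup>L circle_measure g"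
    by (intro tendsto_mult poly_limit_integral[OF _ p] poly_limit_integral[OF _ q]
        poly_limit_measurable assms)
  with poly_limit_integral[OF m b l] show "(LINT z|circle_measure. f z * g z) =
      integral\<^sup>L circle_measure f * integral\<^sup>L circle_measure g"
    by (intro LIMSEQ_unique) auto
qed

lemma poly_limit_prod:
  assumes "finite A" "\<And>i. i \<in> A \<Longrightarrow> poly_limit (f i)"
  shows "poly_limit (\<lambda>z. \<Prod>i\<in>A. f i z)"
  using assms
proof (induction A rule: finite_induct)
  case (insert i A)
  then show ?case by (simp add: poly_limit_mult(1))
qed simp

lemma poly_limit_coeff:
  assumes "poly_limit f" "k > 0"
  shows "(LINT z|circle_measure. f z * z ^ k) = 0"
proof -
  have "poly (monom 1 k) = (\<lambda>z::complex. z ^ k)" by (simp add: fun_eq_iff poly_monom)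
  then show ?thesis
    using poly_limit_mult(2)[OF assms(1) poly_limit_poly[of "monom 1 k"]] assms(2)
    by (simp add: integral_circle_power)
qed

text \<open>The exponential series converges uniformly on the bounded set of values of
  \<open>q\<close>. The whole disc is used, and not only the circle, because the value at 0 carries
  the mean.\<close>

lemma exp_poly_approx:
  fixes q :: "complex poly"
  assumes "e > 0"
  obtains P where "\<And>z. z \<in> cball 0 1 \<Longrightarrow> cmod (poly P z - exp (poly q z)) < e"
proof -
  have "bounded (poly q ` cball 0 1)"
    by (intro compact_imp_bounded compact_continuous_image continuous_intros) auto
  then obtain R where R: "\<And>z. z \<in> cball 0 1 \<Longrightarrow> cmod (poly q z) \<le> R"
    unfolding bounded_iff by blast
  have "uniform_limit (cball 0 R) (\<lambda>n w::complex. \<Sum>i<n. w ^ i /\<^sub>R fact i)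
      (\<lambda>w. suminf (\<lambda>i. w ^ i /\<^sub>R fact i)) sequentially"
  proof (rule Weierstrass_m_test)
    show "summable (\<lambda>n. R ^ n /\<^sub>R fact n)"
      using summable_exp_generic[of R] by simp
    show "norm (w ^ n /\<^sub>R fact n) \<le> R ^ n /\<^sub>R fact n" if "w \<in> cball 0 R" for n and w :: complex
      using that by (auto simp: norm_power intro!: mult_left_mono power_mono)
  qed
  then have "\<forall>\<^sub>F n in sequentially. \<forall>w\<in>cball 0 R. dist (\<Sum>i<n. (w::complex) ^ i /\<^sub>R fact i) (exp w) < e"
    using assms by (simp add: uniform_limit_iff exp_def)
  then obtain n where n: "\<And>w::complex. w \<in> cball 0 R \<Longrightarrow> dist (\<Sum>i<n. w ^ i /\<^sub>R fact i) (exp w) < e"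
    unfolding eventually_sequentially by blast
  define P where "P = (\<Sum>i<n. smult (of_real (1 / fact i)) (q ^ i))"
  have P: "poly P z = (\<Sum>i<n. poly q z ^ i /\<^sub>R fact i)" for z
    by (simp add: P_def poly_sum scaleR_conv_of_real divide_simps)
  show ?thesis
  proof
    show "cmod (poly P z - exp (poly q z)) < e" if "z \<in> cball 0 1" for z
      using n[of "poly q z"] R[OF that] by (simp add: P dist_norm)
  qed
qed

text \<open>The modulus of \<open>exp\<close> sees only the real part, so an upper bound on
  \<open>Re\<close> suffices and the imaginary parts may be unbounded, as harmonic conjugates of
  bounded functions can be. Convergence at 0 is a separate hypothesis for the same reason: the
  \<open>q n\<close> themselves need not be dominated on the circle.\<close>

lemma poly_limit_exp:
  assumes F: "F \<in> borel_measurable circle_measure"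
    and q: "\<And>n z. z \<in> sphere 0 1 \<Longrightarrow> Re (poly (q n) z) \<le> C"
    and lim: "AE z in circle_measure. (\<lambda>n. poly (q n) z) \<longlonglongrightarrow> F z"
    and lim0: "(\<lambda>n. poly (q n) 0) \<longlonglongrightarrow> a"
  shows "poly_limit (\<lambda>z. exp (F z))" "(LINT z|circle_measure. exp (F z)) = exp a"
proof -
  have "\<exists>P. \<forall>z\<in>cball 0 1. cmod (poly P z - exp (poly (q n) z)) < inverse (real (Suc n))" for n
    by (rule exp_poly_approx[of "inverse (real (Suc n))" "q n"]) (simp, blast)
  then obtain P where P: "\<And>n z. z \<in> cball 0 1 \<Longrightarrow>
      cmod (poly (P n) z - exp (poly (q n) z)) < inverse (real (Suc n))"
    by metis
  have lim': "(\<lambda>n. poly (P n) z) \<longlonglongrightarrow> exp w"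
    if "z \<in> cball 0 1" "(\<lambda>n. poly (q n) z) \<longlonglongrightarrow> w" for z w
  proof -
    have "(\<lambda>n. poly (P n) z - exp (poly (q n) z)) \<longlonglongrightarrow> 0"
      by (rule Lim_null_comparison[OF _ LIMSEQ_inverse_real_of_nat])
        (use P[OF that(1)] in \<open>auto intro!: always_eventually less_imp_le\<close>)
    from tendsto_add[OF this tendsto_exp[OF that(2)]] show ?thesis by simp
  qed
  have m: "(\<lambda>z. exp (F z)) \<in> borel_measurable circle_measure"
    by (rule measurable_compose[OF F]) (intro borel_measurable_continuous_onI continuous_intros)
  have b: "cmod (poly (P n) z) \<le> 1 + exp C" if "z \<in> sphere 0 1" for n z
  proof -
    have "cmod (poly (P n) z - exp (poly (q n) z)) < 1"
      by (rule less_le_trans[OF P]) (use that in \<open>auto simp: inverse_le_1_iff\<close>)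
    moreover have "cmod (exp (poly (q n) z)) \<le> exp C"
      using q[OF that] by simp
    ultimately show ?thesis
      using norm_triangle_sub[of "poly (P n) z" "exp (poly (q n) z)"] by linarith
  qed
  have "AE z in circle_measure. z \<in> cball 0 1"
    by (rule AE_circleI) simp
  with lim have l: "AE z in circle_measure. (\<lambda>n. poly (P n) z) \<longlonglongrightarrow> exp (F z)"
    by eventually_elim (rule lim')
  show "poly_limit (\<lambda>z. exp (F z))"
    by (rule poly_limitI[OF m b l])
  from poly_limit_integral[OF m b l] lim'[OF _ lim0]
  show "(LINT z|circle_measure. exp (F z)) = exp a"
    by (intro LIMSEQ_unique) auto
qed

section \<open>Continuous and trigonometric approximation\<close>

text \<open>Lusin's theorem for indicators. Open \<open>U\<close> and \<open>V\<close> that barely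
  exceed \<open>E\<close> and \<open>- E\<close> cover the plane, so their overlap \<open>e\<close>
  is small; a Urysohn function that is 1 off \<open>V\<close> and 0 off \<open>U\<close> agrees with
  the indicator away from the overlap.\<close>

lemma indicator_eq_continuous_off_small_set:
  assumes E: "E \<in> sets circle_measure" and "\<eta> > 0"
  obtains \<phi> :: "complex \<Rightarrow> real" and e where "continuous_on UNIV \<phi>" "\<And>z. 0 \<le> \<phi> z \<and> \<phi> z \<le> 1"
    "e \<in> sets circle_measure" "measure circle_measure e < \<eta>"
    "\<And>z. z \<in> sphere 0 1 - e \<Longrightarrow> \<phi> z = indicator E z"
proof -
  have sph: "sphere (0::complex) 1 \<in> sets borel" by (simp add: borel_closed)
  have id: "(\<lambda>z. z) \<in> circle_measure \<rightarrow>\<^sub>M borel"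
    using continuous_on_id by (rule borel_measurable_circleI)
  \<comment> \<open>Pushed forward to the plane, the measure is a finite Borel measure, to which
    outer regularity applies.\<close>
  define N where "N = distr circle_measure borel (\<lambda>z::complex. z)"
  interpret N: prob_space N
    unfolding N_def by (rule circle.prob_space_distr[OF id])
  have [simp]: "sets N = sets borel" "space N = UNIV" by (simp_all add: N_def)
  have N: "measure N A = measure circle_measure (A \<inter> sphere 0 1)" if "A \<in> sets borel" for A
    using that by (simp add: N_def measure_distr[OF id] space_circle_measure vimage_def)
  have outer: "\<exists>U. B \<subseteq> U \<and> open U \<and> measure N U < measure N B + \<eta> / 2" if "B \<in> sets borel" for B
  proof -
    have "emeasure N B < ennreal (measure N B + \<eta> / 2)"
      unfolding N.emeasure_eq_measure using \<open>\<eta> > 0\<close> by (intro ennreal_lessI) (auto intro: add_nonneg_pos)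
    then have "(INF U \<in> {U. B \<subseteq> U \<and> open U}. emeasure N U) < ennreal (measure N B + \<eta> / 2)"
      using that by (subst outer_regular[symmetric]) (auto simp: N.emeasure_space_1)
    then show ?thesis
      by (auto simp: INF_less_iff N.emeasure_eq_measure ennreal_less_iff)
  qed
  have Eb: "E \<in> sets borel" "E \<subseteq> sphere 0 1"
    using E sph by (auto simp: sets_circle_measure sets_restrict_space_iff)
  obtain U where U: "E \<subseteq> U" "open U" "measure N U < measure N E + \<eta> / 2"
    using outer[OF Eb(1)] by blast
  obtain V where V: "- E \<subseteq> V" "open V" "measure N V < measure N (- E) + \<eta> / 2"
    using outer[of "- E"] Eb(1) by auto
  have UV: "U \<union> V = UNIV" using U V by auto
  have "measure N U + measure N V = measure N (U \<union> V) + measure N (U \<inter> V)"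
    using U V by (simp add: N.finite_measure_Union' N.finite_measure_Diff' measure_Un3 N.fmeasurable_eq_sets)
  moreover have "measure N (- E) = 1 - measure N E"
    using Eb N.prob_compl[of E] by (simp add: Compl_eq_Diff_UNIV)
  ultimately have small: "measure N (U \<inter> V) < \<eta>"
    using U(3) V(3) UV N.prob_space by simp
  obtain \<phi> :: "complex \<Rightarrow> real" where \<phi>: "continuous_on UNIV \<phi>" "\<And>z. \<phi> z \<in> closed_segment 1 0"
    "\<And>z. z \<in> - V \<Longrightarrow> \<phi> z = 1" "\<And>z. z \<in> - U \<Longrightarrow> \<phi> z = 0"
    using Urysohn[of "- V" "- U" "1::real" 0] U V UV by (auto simp: closed_def)
  show ?thesis
  proof (rule that[of \<phi> "U \<inter> V \<inter> sphere 0 1"])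
    show "U \<inter> V \<inter> sphere 0 1 \<in> sets circle_measure"
      using U V sph by (auto simp: sets_circle_measure sets_restrict_space_iff)
    show "measure circle_measure (U \<inter> V \<inter> sphere 0 1) < \<eta>"
      using small U V by (subst N[symmetric]) auto
    show "0 \<le> \<phi> z \<and> \<phi> z \<le> 1" for z
      using \<phi>(2)[of z] by (auto simp: closed_segment_eq_real_ivl split: if_splits)
    show "\<phi> z = indicator E z" if "z \<in> sphere 0 1 - U \<inter> V \<inter> sphere 0 1" for z
    proof (cases "z \<in> U")
      case True
      with that have "z \<in> - V" by auto
      with V show ?thesis by (auto simp: \<phi>(3) indicator_def)
    next
      case False
      with U show ?thesis by (auto simp: \<phi>(4) indicator_def)
    qed
  qed fact
qed

text \<open>Trigonometric polynomials, since \<open>1 / z = cnj z\<close> on the circle. A single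
  common denominator reduces sums and products to polynomial arithmetic.\<close>

definition laurent_on_circle :: "(complex \<Rightarrow> complex) \<Rightarrow> bool" where
  "laurent_on_circle g \<longleftrightarrow> (\<exists>N q. \<forall>z\<in>sphere 0 1. g z = poly q z / z ^ N)"

lemma laurent_on_circleI:
  "(\<And>z. cmod z = 1 \<Longrightarrow> g z = poly q z / z ^ N) \<Longrightarrow> laurent_on_circle g"
  unfolding laurent_on_circle_def by force

lemma laurent_on_circle_add:
  assumes "laurent_on_circle f" "laurent_on_circle g"
  shows "laurent_on_circle (\<lambda>z. f z + g z)"
proof -
  obtain M p where f: "\<And>z. cmod z = 1 \<Longrightarrow> f z = poly p z / z ^ M"
    using assms(1) by (auto simp: laurent_on_circle_def)
  obtain N q where g: "\<And>z. cmod z = 1 \<Longrightarrow> g z = poly q z / z ^ N"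
    using assms(2) by (auto simp: laurent_on_circle_def)
  show ?thesis
  proof (rule laurent_on_circleI)
    fix z :: complex assume z: "cmod z = 1"
    then have "z \<noteq> 0" by auto
    then show "f z + g z = poly (p * monom 1 N + q * monom 1 M) z / z ^ (M + N)"
      by (simp add: f[OF z] g[OF z] poly_monom field_simps power_add)
  qed
qed

lemma laurent_on_circle_mult:
  assumes "laurent_on_circle f" "laurent_on_circle g"
  shows "laurent_on_circle (\<lambda>z. f z * g z)"
proof -
  obtain M p where f: "\<And>z. cmod z = 1 \<Longrightarrow> f z = poly p z / z ^ M"
    using assms(1) by (auto simp: laurent_on_circle_def)
  obtain N q where g: "\<And>z. cmod z = 1 \<Longrightarrow> g z = poly q z / z ^ N"
    using assms(2) by (auto simp: laurent_on_circle_def)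
  show ?thesis
    by (rule laurent_on_circleI[of _ "p * q" "M + N"]) (simp add: f g power_add)
qed

lemma laurent_on_circle_const: "laurent_on_circle (\<lambda>_. c)"
  by (rule laurent_on_circleI[of _ "[:c:]" 0]) simp

lemma laurent_on_circle_linear:
  assumes "bounded_linear (f :: complex \<Rightarrow> real)"
  shows "laurent_on_circle (\<lambda>z. of_real (f z))"
proof (rule laurent_on_circleI)
  interpret f: bounded_linear f by fact
  fix z :: complex assume z: "cmod z = 1"
  then have "z \<noteq> 0" by auto
  have cnj: "cnj z = 1 / z"
    using complex_norm_square[of z] z \<open>z \<noteq> 0\<close> by (simp add: field_simps)
  have "z = Re z *\<^sub>R 1 + Im z *\<^sub>R \<i>"
    by (simp add: complex_eq_iff)
  then have "f z = Re z * f 1 + Im z * f \<i>"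
    by (metis f.add f.scaleR real_scaleR_def)
  moreover have "(z + cnj z) / 2 = of_real (Re z)" "(z - cnj z) / (2 * \<i>) = of_real (Im z)"
    by (simp_all add: complex_eq_iff)
  ultimately have "of_real (f z) = (z + cnj z) / 2 * of_real (f 1) + (z - cnj z) / (2 * \<i>) * of_real (f \<i>)"
    by simp
  also have "\<dots> = poly ([:of_real (f 1) / 2 + \<i> * of_real (f \<i>) / 2, 0, of_real (f 1) / 2 - \<i> * of_real (f \<i>) / 2:]) z / z ^ 1"
    using \<open>z \<noteq> 0\<close> by (simp add: cnj field_simps)
  finally show "of_real (f z) = \<dots>" .
qed

lemma laurent_on_circle_real_polynomial:
  assumes "real_polynomial_function g"
  shows "laurent_on_circle (\<lambda>z. of_real (g z))"
  using assms
  by (induction rule: real_polynomial_function.induct)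
    (simp_all add: laurent_on_circle_linear laurent_on_circle_const laurent_on_circle_add
      laurent_on_circle_mult)

text \<open>Replacing a term of negative frequency by its complex conjugate does not change the real
  part, and on the circle the conjugate is a monomial of positive degree.\<close>

lemma Re_poly_of_laurent:
  assumes "laurent_on_circle (\<lambda>z. of_real (g z))"
  obtains p where "\<And>z. cmod z = 1 \<Longrightarrow> Re (poly p z) = g z" "Im (poly p 0) = 0"
proof -
  obtain N q where q: "\<And>z. cmod z = 1 \<Longrightarrow> of_real (g z) = poly q z / z ^ N"
    using assms by (auto simp: laurent_on_circle_def)
  define p where "p = (\<Sum>i\<le>degree q. if N \<le> i then monom (coeff q i) (i - N)
    else monom (cnj (coeff q i)) (N - i))"
  have "Re (poly p z) = g z" if z: "cmod z = 1" for z
  proof -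
    have "z \<noteq> 0" using z by auto
    have cnj: "inverse z = cnj z"
      using complex_norm_square[of z] z \<open>z \<noteq> 0\<close> by (simp add: field_simps)
    have coeff_eq: "Re (coeff q i * z ^ i / z ^ N) =
        Re (poly (if N \<le> i then monom (coeff q i) (i - N) else monom (cnj (coeff q i)) (N - i)) z)" for i
    proof (cases "N \<le> i")
      case True
      then show ?thesis
        using \<open>z \<noteq> 0\<close> by (simp add: poly_monom power_diff)
    next
      case False
      then have "z ^ i / z ^ N = inverse z ^ (N - i)"
        using \<open>z \<noteq> 0\<close> by (simp add: power_diff power_inverse field_simps)
      also have "\<dots> = cnj (z ^ (N - i))" by (simp add: cnj)
      finally have "Re (coeff q i * z ^ i / z ^ N) = Re (cnj (cnj (coeff q i) * z ^ (N - i)))"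
        by (simp add: times_divide_eq_right[symmetric] del: times_divide_eq_right)
      then show ?thesis
        by (simp only: poly_monom False if_False cnj.sel)
    qed
    have "g z = Re (poly q z / z ^ N)"
      by (simp add: q[OF z, symmetric])
    also have "\<dots> = (\<Sum>i\<le>degree q. Re (coeff q i * z ^ i / z ^ N))"
      by (simp add: poly_altdef sum_divide_distrib)
    also have "\<dots> = Re (poly p z)"
      by (simp only: coeff_eq p_def poly_sum Re_sum)
    finally show ?thesis by simp
  qed
  \<comment> \<open>Subtracting an imaginary constant makes the value at 0 real and leaves the real
    part alone.\<close>
  then show ?thesis
    by (intro that[of "p - [:\<i> * Im (poly p 0):]"]) auto
qed

lemma laurent_approx:
  fixes \<phi> :: "complex \<Rightarrow> real"
  assumes "continuous_on UNIV \<phi>" "\<epsilon> > 0"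
  obtains g where "laurent_on_circle (\<lambda>z. of_real (g z))" "\<And>z. cmod z = 1 \<Longrightarrow> \<bar>\<phi> z - g z\<bar> < \<epsilon>"
proof -
  have "continuous_on (sphere 0 1) \<phi>" using assms(1) continuous_on_subset by blast
  then obtain g where "real_polynomial_function g" "\<And>z. z \<in> sphere 0 1 \<Longrightarrow> \<bar>\<phi> z - g z\<bar> < \<epsilon>"
    using Stone_Weierstrass_real_polynomial_function[of "sphere (0::complex) 1" \<phi> \<epsilon>] assms(2) by auto
  then show ?thesis
    by (intro that[of g] laurent_on_circle_real_polynomial) auto
qed

text \<open>Density of the continuous functions in \<open>L^1\<close>, by induction over integrable
  functions. For a multiple of an indicator, the error lives on the exceptional set of the Lusin
  lemma.\<close>

lemma continuous_L1_approx:
  fixes w :: "complex \<Rightarrow> real"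
  assumes "integrable circle_measure w" "\<epsilon> > 0"
  shows "\<exists>\<phi>. continuous_on UNIV \<phi> \<and> integrable circle_measure \<phi> \<and>
    (LINT z|circle_measure. \<bar>w z - \<phi> z\<bar>) < \<epsilon>"
  using assms
proof (induction arbitrary: \<epsilon> rule: integrable_induct)
  case (base A c)
  show ?case
  proof (cases "c = 0")
    case True
    with base show ?thesis by (intro exI[of _ "\<lambda>_. 0"]) auto
  next
    case False
    obtain \<phi> :: "complex \<Rightarrow> real" and e where \<phi>: "continuous_on UNIV \<phi>" "\<And>z. 0 \<le> \<phi> z \<and> \<phi> z \<le> 1"
      "e \<in> sets circle_measure" "measure circle_measure e < \<epsilon> / \<bar>c\<bar>"
      "\<And>z. z \<in> sphere 0 1 - e \<Longrightarrow> \<phi> z = indicator A z"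
      using indicator_eq_continuous_off_small_set[of A "\<epsilon> / \<bar>c\<bar>"] base False by (metis divide_pos_pos zero_less_abs_iff)
    have m [measurable]: "\<phi> \<in> borel_measurable circle_measure" "A \<in> sets circle_measure"
      using \<phi>(1) continuous_on_subset base by (auto intro!: borel_measurable_circleI)
    have i: "integrable circle_measure \<phi>"
      using \<phi>(2) by (intro integrable_circle_bounded[of _ 1]) auto
    have "(LINT z|circle_measure. \<bar>indicator A z *\<^sub>R c - c * \<phi> z\<bar>) \<le>
        (LINT z|circle_measure. \<bar>c\<bar> * indicator e z)"
    proof (rule integral_mono)
      show "integrable circle_measure (\<lambda>z. \<bar>indicator A z *\<^sub>R c - c * \<phi> z\<bar>)"
        using i base by auto
      show "\<bar>indicator A z *\<^sub>R c - c * \<phi> z\<bar> \<le> \<bar>c\<bar> * indicator e z" if "z \<in> space circle_measure" for z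
      proof (cases "z \<in> e")
        case True
        have "\<bar>indicator A z *\<^sub>R c - c * \<phi> z\<bar> = \<bar>c\<bar> * \<bar>indicator A z - \<phi> z\<bar>"
          by (simp add: abs_mult[symmetric] algebra_simps)
        also have "\<dots> \<le> \<bar>c\<bar> * 1"
          using \<phi>(2)[of z] by (intro mult_left_mono) (auto simp: indicator_def)
        finally show ?thesis using True by simp
      next
        case False
        then show ?thesis using \<phi>(5)[of z] that by (simp add: space_circle_measure)
      qed
      show "integrable circle_measure (\<lambda>z. \<bar>c\<bar> * indicator e z)"
        using \<phi>(3) by (intro integrable_mult_right integrable_real_indicator) (auto simp: circle.emeasure_eq_measure)
    qed
    also have "\<dots> = \<bar>c\<bar> * measure circle_measure e" using \<phi>(3) by simp
    also have "\<dots> < \<epsilon>" using \<phi>(4) False by (simp add: field_simps)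
    finally show ?thesis
      using \<phi>(1) i by (intro exI[of _ "\<lambda>z. c * \<phi> z"]) (auto intro!: continuous_intros)
  qed
next
  case (add f g)
  obtain \<phi> where \<phi>: "continuous_on UNIV \<phi>" "integrable circle_measure \<phi>"
      "(LINT z|circle_measure. \<bar>f z - \<phi> z\<bar>) < \<epsilon> / 2"
    using add.IH(1)[of "\<epsilon> / 2"] add.prems by auto
  obtain \<psi> where \<psi>: "continuous_on UNIV \<psi>" "integrable circle_measure \<psi>"
      "(LINT z|circle_measure. \<bar>g z - \<psi> z\<bar>) < \<epsilon> / 2"
    using add.IH(2)[of "\<epsilon> / 2"] add.prems by auto
  have "(LINT z|circle_measure. \<bar>(f z + g z) - (\<phi> z + \<psi> z)\<bar>) \<le>
      (LINT z|circle_measure. \<bar>f z - \<phi> z\<bar> + \<bar>g z - \<psi> z\<bar>)"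
    using add.hyps \<phi> \<psi> by (intro integral_mono) auto
  also have "\<dots> < \<epsilon>"
    using add.hyps \<phi> \<psi> by (subst Bochner_Integration.integral_add) auto
  finally show ?case
    using \<phi> \<psi> by (intro exI[of _ "\<lambda>z. \<phi> z + \<psi> z"]) (auto intro!: continuous_intros)
next
  case (lim f s)
  have "(\<lambda>i. LINT z|circle_measure. norm (s i z - f z)) \<longlonglongrightarrow> (LINT z|circle_measure. (0::real))"
  \<comment> \<open>The induction rule provides
    \<open>\<bar>s i z\<bar> \<le> 2 * \<bar>f z\<bar>\<close>; adding
    \<open>\<bar>f z\<bar>\<close> gives the factor 3.\<close>
  proof (rule integral_dominated_convergence[where w = "\<lambda>z. 3 * \<bar>f z\<bar>"])
    show "AE z in circle_measure. (\<lambda>i. norm (s i z - f z)) \<longlonglongrightarrow> 0"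
      using lim.hyps(2) by (intro AE_I2 tendsto_norm_zero) (simp add: LIM_zero)
    show "AE z in circle_measure. norm (norm (s i z - f z)) \<le> 3 * \<bar>f z\<bar>" for i
    proof (rule AE_I2)
      show "norm (norm (s i z - f z)) \<le> 3 * \<bar>f z\<bar>" if "z \<in> space circle_measure" for z
        using lim.hyps(3)[OF that, of i] by simp
    qed
  qed (use lim.hyps in auto)
  then obtain i where i: "(LINT z|circle_measure. norm (s i z - f z)) < \<epsilon> / 2"
    using lim.prems by (auto dest!: order_tendstoD(2)[where a = "\<epsilon> / 2"] eventually_happens)
  obtain \<phi> where \<phi>: "continuous_on UNIV \<phi>" "integrable circle_measure \<phi>"
      "(LINT z|circle_measure. \<bar>s i z - \<phi> z\<bar>) < \<epsilon> / 2"
    using lim.IH[of "\<epsilon> / 2" i] lim.prems by auto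
  have "(LINT z|circle_measure. \<bar>f z - \<phi> z\<bar>) \<le>
      (LINT z|circle_measure. norm (s i z - f z) + \<bar>s i z - \<phi> z\<bar>)"
    using lim.hyps \<phi> by (intro integral_mono) auto
  also have "\<dots> < \<epsilon>"
    using lim.hyps \<phi> i by (subst Bochner_Integration.integral_add) auto
  finally show ?case using \<phi> by blast
qed

section \<open>Outer functions\<close>

text \<open>An \<open>L^1\<close> approximation, cut off at \<open>C\<close>, differs from
  \<open>w\<close> by at most \<open>2 * C\<close>, so the squared error is controlled by the error
  itself. The uniform bound on \<open>Re\<close> is kept because exponentials of these polynomials
  are to be taken.\<close>

lemma poly_L2_approx:
  fixes w :: "complex \<Rightarrow> real"
  assumes [measurable]: "w \<in> borel_measurable circle_measure" and C: "\<And>z. \<bar>w z\<bar> \<le> C" and "\<epsilon> > 0"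
  obtains p where "\<And>z. cmod z = 1 \<Longrightarrow> \<bar>Re (poly p z)\<bar> \<le> C + 1" "Im (poly p 0) = 0"
    "(LINT z|circle_measure. (w z - Re (poly p z))\<^sup>2) \<le> \<epsilon>"
proof -
  have "C \<ge> 0" using C[of 0] by linarith
  \<comment> \<open>The bound 1 yields \<open>C + 1\<close> in the conclusion; the other one makes
    \<open>(2 * C + 1) * (\<delta> + \<delta>)\<close> at most \<open>\<epsilon>\<close>.\<close>
  define \<delta> where "\<delta> = min 1 (\<epsilon> / (2 * (2 * C + 1)))"
  have "\<delta> > 0" using \<open>\<epsilon> > 0\<close> \<open>C \<ge> 0\<close> by (simp add: \<delta>_def)
  have [simp]: "integrable circle_measure w"
    using C by (intro integrable_circle_bounded[of _ C]) auto
  obtain \<phi>0 where \<phi>0: "continuous_on UNIV \<phi>0" "integrable circle_measure \<phi>0"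
      "(LINT z|circle_measure. \<bar>w z - \<phi>0 z\<bar>) < \<delta>"
    using continuous_L1_approx[of w \<delta>] \<open>\<delta> > 0\<close> by auto
  define \<phi> where "\<phi> z = max (- C) (min C (\<phi>0 z))" for z
  have \<phi>: "continuous_on UNIV \<phi>" using \<phi>0(1) unfolding \<phi>_def by (intro continuous_intros)
  obtain g where g: "laurent_on_circle (\<lambda>z. of_real (g z))" "\<And>z. cmod z = 1 \<Longrightarrow> \<bar>\<phi> z - g z\<bar> < \<delta>"
    using laurent_approx[OF \<phi> \<open>\<delta> > 0\<close>] by blast
  obtain p where p: "\<And>z. cmod z = 1 \<Longrightarrow> Re (poly p z) = g z" "Im (poly p 0) = 0"
    using Re_poly_of_laurent[OF g(1)] by blast
  have sq: "(w z - Re (poly p z))\<^sup>2 \<le> (2 * C + 1) * (\<bar>w z - \<phi>0 z\<bar> + \<delta>)" if z: "cmod z = 1" for z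
  proof -
    have 1: "\<bar>w z - \<phi> z\<bar> \<le> 2 * C" "\<bar>w z - \<phi> z\<bar> \<le> \<bar>w z - \<phi>0 z\<bar>"
      using C[of z] by (auto simp: \<phi>_def)
    have 2: "\<bar>w z - Re (poly p z)\<bar> \<le> \<bar>w z - \<phi> z\<bar> + \<delta>"
      using g(2)[OF z] p(1)[OF z] by linarith
    have "(w z - Re (poly p z))\<^sup>2 = \<bar>w z - Re (poly p z)\<bar> * \<bar>w z - Re (poly p z)\<bar>"
      by (simp add: power2_eq_square)
    also have "\<dots> \<le> (2 * C + 1) * (\<bar>w z - \<phi>0 z\<bar> + \<delta>)"
      using 1 2 by (intro mult_mono) (auto simp: \<delta>_def)
    finally show ?thesis .
  qed
  have [simp]: "integrable circle_measure (\<lambda>z. Re (poly p z))"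
    using integrable_poly by (rule integrable_Re)
  have "integrable circle_measure (\<lambda>z. (w z - Re (poly p z))\<^sup>2)"
  proof (rule Bochner_Integration.integrable_bound)
    show "integrable circle_measure (\<lambda>z. (2 * C + 1) * (\<bar>w z - \<phi>0 z\<bar> + \<delta>))"
      using \<phi>0 by auto
    show "AE z in circle_measure. norm ((w z - Re (poly p z))\<^sup>2) \<le> norm ((2 * C + 1) * (\<bar>w z - \<phi>0 z\<bar> + \<delta>))"
      by (rule AE_circleI) (use sq in force)
  qed measurable
  then have "(LINT z|circle_measure. (w z - Re (poly p z))\<^sup>2) \<le>
      (LINT z|circle_measure. (2 * C + 1) * (\<bar>w z - \<phi>0 z\<bar> + \<delta>))"
    using \<phi>0 sq by (intro integral_mono) (auto simp: space_circle_measure)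
  also have "\<dots> = (2 * C + 1) * ((LINT z|circle_measure. \<bar>w z - \<phi>0 z\<bar>) + \<delta>)"
    using \<phi>0 by (simp add: circle.prob_space)
  also have "\<dots> \<le> (2 * C + 1) * (\<delta> + \<delta>)"
    using \<phi>0 \<open>C \<ge> 0\<close> by (intro mult_left_mono) auto
  also have "\<dots> = \<delta> * (2 * (2 * C + 1))" by (simp add: algebra_simps)
  also have "\<dots> \<le> \<epsilon>"
    using \<open>C \<ge> 0\<close> by (subst pos_le_divide_eq[symmetric]) (auto simp: \<delta>_def)
  finally have L2: "(LINT z|circle_measure. (w z - Re (poly p z))\<^sup>2) \<le> \<epsilon>" .
  have "\<bar>Re (poly p z)\<bar> \<le> C + 1" if z: "cmod z = 1" for z
  proof -
    have "\<bar>\<phi> z\<bar> \<le> C" using \<open>C \<ge> 0\<close> by (auto simp: \<phi>_def)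
    moreover have "\<delta> \<le> 1" by (simp add: \<delta>_def)
    ultimately show ?thesis
      using g(2)[OF z] p(1)[OF z] by linarith
  qed
  then show ?thesis using that p(2) L2 by blast
qed

lemma continuous_integrable_circle:
  fixes f :: "complex \<Rightarrow> 'b::{banach, second_countable_topology}"
  assumes "continuous_on (sphere 0 1) f"
  shows "integrable circle_measure f"
proof -
  have "bounded (f ` sphere 0 1)"
    using assms by (intro compact_imp_bounded compact_continuous_image) auto
  then obtain B where B: "\<And>z. cmod z = 1 \<Longrightarrow> norm (f z) \<le> B"
    unfolding bounded_iff by (metis image_eqI mem_sphere_0)
  have "f \<in> borel_measurable circle_measure"
    using borel_measurable_continuous_on_restrict[OF assms]
    by (simp add: measurable_cong_sets[OF sets_circle_measure refl])
  then show ?thesis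
    by (rule integrable_circle_bounded[of _ B]) (rule AE_circleI, rule B)
qed

text \<open>The square of a polynomial has mean \<open>q(0)\<^sup>2 \<ge> 0\<close>, so the imaginary part has at most the
  \<open>L\<^sup>2\<close> norm of the real part.\<close>

lemma poly_L2_le_Re:
  assumes "Im (poly q 0) = 0"
  shows "(LINT z|circle_measure. (cmod (poly q z))\<^sup>2) \<le> 2 * (LINT z|circle_measure. (Re (poly q z))\<^sup>2)"
proof -
  have i: "integrable circle_measure (\<lambda>z. (Re (poly q z))\<^sup>2)" "integrable circle_measure (\<lambda>z. (Im (poly q z))\<^sup>2)"
    by (auto intro!: continuous_integrable_circle continuous_intros)
  have "(LINT z|circle_measure. (Re (poly q z))\<^sup>2) - (LINT z|circle_measure. (Im (poly q z))\<^sup>2) =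
      (LINT z|circle_measure. Re (poly (q\<^sup>2) z))"
    using i by (simp add: Re_power2 poly_power)
  also have "\<dots> = Re (poly (q\<^sup>2) 0)"
    by (subst integral_Re[OF integrable_poly]) (simp only: integral_poly)
  also have "\<dots> \<ge> 0" using assms by (simp add: Re_power2 poly_power)
  finally show ?thesis
    using i by (simp add: cmod_power2)
qed

text \<open>The sum of the norms has finite integral by monotone convergence, hence is finite almost
  everywhere. This turns summable \<open>L^1\<close> errors into pointwise convergence of the full
  sequence.\<close>

lemma AE_summable_norm:
  fixes f :: "nat \<Rightarrow> complex \<Rightarrow> 'b::{banach, second_countable_topology}"
  assumes [measurable]: "\<And>n. integrable circle_measure (f n)"
    and le: "\<And>n. (LINT z|circle_measure. norm (f n z)) \<le> c n" and "summable c"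
  shows "AE z in circle_measure. summable (\<lambda>n. norm (f n z))"
proof -
  have c0: "0 \<le> c n" for n
    by (rule order_trans[OF _ le]) (rule Bochner_Integration.integral_nonneg, simp)
  have "(\<integral>\<^sup>+z. (\<Sum>n. ennreal (norm (f n z))) \<partial>circle_measure) =
      (\<Sum>n. \<integral>\<^sup>+z. ennreal (norm (f n z)) \<partial>circle_measure)"
    by (rule nn_integral_suminf) measurable
  also have "\<dots> = (\<Sum>n. ennreal (LINT z|circle_measure. norm (f n z)))"
    using assms(1) by (subst nn_integral_eq_integral) auto
  also have "\<dots> \<le> (\<Sum>n. ennreal (c n))"
    by (intro suminf_le ennreal_leI le) auto
  also have "\<dots> < \<infinity>"
    using c0 \<open>summable c\<close> by (simp add: suminf_ennreal2 less_top[symmetric])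
  finally have "AE z in circle_measure. (\<Sum>n. ennreal (norm (f n z))) \<noteq> \<infinity>"
    by (intro nn_integral_PInf_AE) auto
  then show ?thesis
    by eventually_elim (auto intro: summable_suminf_not_top)
qed

text \<open>The inequality of arithmetic and geometric means with a free weight, used in place of
  Cauchy-Schwarz.\<close>

lemma abs_le_weighted_square:
  fixes x :: real
  assumes "t > 0"
  shows "\<bar>x\<bar> \<le> (1 / t + t * x\<^sup>2) / 2"
proof -
  have "0 \<le> (1 - t * \<bar>x\<bar>)\<^sup>2 / t" using assms by simp
  also have "\<dots> = 1 / t + t * x\<^sup>2 - 2 * \<bar>x\<bar>"
    using assms by (simp add: power2_eq_square field_simps)
  finally show ?thesis by simp
qed

lemma L1_le_L2:
  fixes f :: "complex \<Rightarrow> real"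
  assumes "integrable circle_measure f" "integrable circle_measure (\<lambda>z. (f z)\<^sup>2)"
    and "(LINT z|circle_measure. (f z)\<^sup>2) \<le> K / t\<^sup>2" "t > 0"
  shows "(LINT z|circle_measure. \<bar>f z\<bar>) \<le> (1 + K) / (2 * t)"
proof -
  have "(LINT z|circle_measure. \<bar>f z\<bar>) \<le> (LINT z|circle_measure. (1 / t + t * (f z)\<^sup>2) / 2)"
    using assms by (intro integral_mono abs_le_weighted_square) auto
  also have "\<dots> = (1 / t + t * (LINT z|circle_measure. (f z)\<^sup>2)) / 2"
    using assms by (simp add: circle.prob_space)
  also have "\<dots> \<le> (1 / t + t * (K / t\<^sup>2)) / 2"
    using assms by (intro divide_right_mono add_left_mono mult_left_mono) auto
  also have "\<dots> = (1 + K) / (2 * t)"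
    using assms by (simp add: power2_eq_square field_simps)
  finally show ?thesis .
qed

text \<open>Here \<open>F\<close> is \<open>w\<close> plus \<open>\<i>\<close> times its harmonic conjugate, so that \<open>exp \<circ> F\<close> is the outer function
  of modulus \<open>exp \<circ> w\<close>.\<close>

lemma outer_function_exists:
  fixes w :: "complex \<Rightarrow> real"
  assumes [measurable]: "w \<in> borel_measurable circle_measure" and C: "\<And>z. \<bar>w z\<bar> \<le> C"
  obtains F where "F \<in> borel_measurable circle_measure" "AE z in circle_measure. Re (F z) = w z"
    "poly_limit (\<lambda>z. exp (F z))" "poly_limit (\<lambda>z. exp (- F z))"
    "(LINT z|circle_measure. exp (F z)) = of_real (exp (LINT z|circle_measure. w z))"
    "(LINT z|circle_measure. exp (- F z)) = of_real (exp (- (LINT z|circle_measure. w z)))"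
proof -
  have "C \<ge> 0" using C[of 0] by linarith
  have iw [simp]: "integrable circle_measure w"
    using C by (intro integrable_circle_bounded[of _ C]) auto
  \<comment> \<open>A squared \<open>L^2\<close> error of \<open>4 ^ (- n)\<close> gives
    \<open>L^1\<close> errors of order \<open>2 ^ (- n)\<close>, which are summable.\<close>
  have "\<exists>p. (\<forall>z. cmod z = 1 \<longrightarrow> \<bar>Re (poly p z)\<bar> \<le> C + 1) \<and> Im (poly p 0) = 0 \<and>
      (LINT z|circle_measure. (w z - Re (poly p z))\<^sup>2) \<le> 1 / (2 ^ n)\<^sup>2" for n :: nat
    by (rule poly_L2_approx[OF assms, of "1 / (2 ^ n)\<^sup>2"]) (simp, blast)
  then obtain q where q: "\<And>n z. cmod z = 1 \<Longrightarrow> \<bar>Re (poly (q n) z)\<bar> \<le> C + 1"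
      "\<And>n. Im (poly (q n) 0) = 0"
      "\<And>n. (LINT z|circle_measure. (w z - Re (poly (q n) z))\<^sup>2) \<le> 1 / (2 ^ n)\<^sup>2"
    by metis
  have iq [simp]: "integrable circle_measure (\<lambda>z. Re (poly p z))" "integrable circle_measure (\<lambda>z. (Re (poly p z))\<^sup>2)"
      "integrable circle_measure (\<lambda>z. cmod (poly p z))" "integrable circle_measure (\<lambda>z. (cmod (poly p z))\<^sup>2)" for p
    by (auto intro!: continuous_integrable_circle continuous_intros)
  have iw2 [simp]: "integrable circle_measure (\<lambda>z. (w z - Re (poly (q n) z))\<^sup>2)" for n
  proof (rule integrable_circle_bounded)
    show "AE z in circle_measure. norm ((w z - Re (poly (q n) z))\<^sup>2) \<le> (2 * C + 1)\<^sup>2"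
    proof (rule AE_circleI)
      fix z :: complex assume "cmod z = 1"
      then have "\<bar>w z - Re (poly (q n) z)\<bar> \<le> 2 * C + 1"
        using C[of z] q(1)[of z n] by linarith
      then show "norm ((w z - Re (poly (q n) z))\<^sup>2) \<le> (2 * C + 1)\<^sup>2"
        by (simp add: abs_le_square_iff[symmetric])
    qed
  qed measurable
  have L1: "(LINT z|circle_measure. \<bar>w z - Re (poly (q n) z)\<bar>) \<le> (1 + 1) / (2 * 2 ^ n)" for n
    using q(3)[of n] by (intro L1_le_L2) auto
  have AE_Re: "AE z in circle_measure. summable (\<lambda>n. norm (w z - Re (poly (q n) z)))"
  proof (rule AE_summable_norm)
    show "(LINT z|circle_measure. norm (w z - Re (poly (q n) z))) \<le> (1 / 2) ^ n" for n
      using L1[of n] by (simp add: power_divide)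
  qed auto
  \<comment> \<open>The real parts tend to \<open>w\<close> already. The imaginary parts have no
    known limit, so convergence is obtained from consecutive differences, whose \<open>L^2\<close>
    norms are controlled by their real parts.\<close>
  define D where "D n = q (Suc n) - q n" for n
  have D: "(LINT z|circle_measure. (cmod (poly (D n) z))\<^sup>2) \<le> 8 / (2 ^ n)\<^sup>2" for n
  proof -
    have "(LINT z|circle_measure. (Re (poly (D n) z))\<^sup>2) \<le>
        (LINT z|circle_measure. 2 * (w z - Re (poly (q n) z))\<^sup>2 + 2 * (w z - Re (poly (q (Suc n)) z))\<^sup>2)"
    proof (rule integral_mono)
      fix z
      have "(x - y)\<^sup>2 \<le> 2 * (u - y)\<^sup>2 + 2 * (u - x)\<^sup>2" for x y u :: real
        using zero_le_power2[of "2 * u - x - y"] by (simp add: power2_eq_square algebra_simps)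
      then show "(Re (poly (D n) z))\<^sup>2 \<le> 2 * (w z - Re (poly (q n) z))\<^sup>2 + 2 * (w z - Re (poly (q (Suc n)) z))\<^sup>2"
        by (simp add: D_def)
    qed auto
    also have "\<dots> = 2 * (LINT z|circle_measure. (w z - Re (poly (q n) z))\<^sup>2) +
        2 * (LINT z|circle_measure. (w z - Re (poly (q (Suc n)) z))\<^sup>2)"
      by simp
    also have "\<dots> \<le> 2 * (1 / (2 ^ n)\<^sup>2) + 2 * (1 / (2 ^ Suc n)\<^sup>2)"
      by (intro add_mono mult_left_mono q(3)) auto
    also have "\<dots> \<le> 4 / (2 ^ n)\<^sup>2"
      by (simp add: field_simps)
    finally show ?thesis
      using poly_L2_le_Re[of "D n"] q(2) by (simp add: D_def)
  qed
  \<comment> \<open>The bound 8 is twice the bound 4 for the real part; \<open>L1_le_L2\<close> with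
    weight \<open>2 ^ n\<close> turns it into \<open>(1 + 8) / 2\<close>.\<close>
  have "AE z in circle_measure. summable (\<lambda>n. norm (poly (D n) z))"
  proof (rule AE_summable_norm)
    show "(LINT z|circle_measure. norm (poly (D n) z)) \<le> (9/2) * (1 / 2) ^ n" for n
      using L1_le_L2[of "\<lambda>z. cmod (poly (D n) z)" 8 "2 ^ n"] D[of n] by (simp add: power_divide)
  qed auto
  then have conv: "AE z in circle_measure. convergent (\<lambda>n. poly (q n) z)"
  proof eventually_elim
    case (elim z)
    then have "summable (\<lambda>n. poly (q (Suc n)) z - poly (q n) z)"
      unfolding D_def by (simp add: summable_norm_cancel)
    then show ?case
      unfolding summable_iff_convergent sum_lessThan_telescope[of "\<lambda>n. poly (q n) z"]
        convergent_diff_const_right_iff .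
  qed
  define F where "F z = lim (\<lambda>n. poly (q n) z)" for z
  have mF [measurable]: "F \<in> borel_measurable circle_measure"
    unfolding F_def by measurable
  have lim: "AE z in circle_measure. (\<lambda>n. poly (q n) z) \<longlonglongrightarrow> F z"
    using conv by eventually_elim (simp add: F_def convergent_LIMSEQ_iff)
  have Re_F: "AE z in circle_measure. Re (F z) = w z"
    using lim AE_Re
  proof eventually_elim
    case (elim z)
    from elim(2) have "(\<lambda>n. w z - Re (poly (q n) z)) \<longlonglongrightarrow> 0"
      using summable_LIMSEQ_zero tendsto_norm_zero_iff by blast
    then have "(\<lambda>n. w z - (w z - Re (poly (q n) z))) \<longlonglongrightarrow> w z - 0"
      by (intro tendsto_intros)
    with tendsto_Re[OF elim(1)] show ?case
      by (auto intro: LIMSEQ_unique)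
  qed
  have lim0: "(\<lambda>n. poly (q n) 0) \<longlonglongrightarrow> of_real (LINT z|circle_measure. w z)"
  proof -
    \<comment> \<open>The normalisation \<open>Im (poly (q n) 0) = 0\<close> makes this value real,
      so it is the mean of the real part.\<close>
    have "poly (q n) 0 = of_real (LINT z|circle_measure. Re (poly (q n) z))" for n
      using q(2)[of n] by (simp add: integral_Re[OF integrable_poly] integral_poly complex_eq_iff)
    moreover have "(\<lambda>n. LINT z|circle_measure. Re (poly (q n) z)) \<longlonglongrightarrow> (LINT z|circle_measure. w z)"
    proof (rule LIM_zero_cancel)
      have "\<bar>(LINT z|circle_measure. Re (poly (q n) z)) - (LINT z|circle_measure. w z)\<bar> \<le> (1/2) ^ n" for n
      proof -
        have "\<bar>(LINT z|circle_measure. Re (poly (q n) z)) - (LINT z|circle_measure. w z)\<bar> =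
            \<bar>LINT z|circle_measure. w z - Re (poly (q n) z)\<bar>"
          by simp
        also have "\<dots> \<le> (LINT z|circle_measure. \<bar>w z - Re (poly (q n) z)\<bar>)"
          using integral_norm_bound[of circle_measure "\<lambda>z. w z - Re (poly (q n) z)"] by simp
        also have "\<dots> \<le> (1/2) ^ n"
          using L1[of n] by (simp add: power_divide)
        finally show ?thesis .
      qed
      then show "(\<lambda>n. (LINT z|circle_measure. Re (poly (q n) z)) - (LINT z|circle_measure. w z)) \<longlonglongrightarrow> 0"
        by (intro Lim_null_comparison[OF _ LIMSEQ_power_zero[of "1/2::real"]]) auto
    qed
    ultimately show ?thesis by (simp add: tendsto_of_real)
  qed
  \<comment> \<open>The two-sided bound on the real parts is what allows both \<open>exp F\<close>
    and its inverse.\<close>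
  have "Re (poly (q n) z) \<le> C + 1" "Re (poly (- q n) z) \<le> C + 1" if "z \<in> sphere 0 1" for n z
    using q(1)[of z n] that by auto
  note bounds = this
  have lim_neg: "AE z in circle_measure. (\<lambda>n. poly (- q n) z) \<longlonglongrightarrow> - F z"
    using lim by eventually_elim (simp add: tendsto_minus)
  have lim0_neg: "(\<lambda>n. poly (- q n) 0) \<longlonglongrightarrow> - of_real (LINT z|circle_measure. w z)"
    using tendsto_minus[OF lim0] by simp
  have mFn: "(\<lambda>z. - F z) \<in> borel_measurable circle_measure"
    by measurable
  note E = poly_limit_exp[OF mF bounds(1) lim lim0] poly_limit_exp[OF mFn bounds(2) lim_neg lim0_neg]
  show ?thesis
    by (rule that[OF mF Re_F E(1,3)]) (simp_all only: E exp_of_real of_real_minus[symmetric])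
qed

section \<open>Representatives and Douglas algebras\<close>

lemma abs_linfty_cases:
  obtains f where "ess_bounded f" "x = abs_linfty f"
proof -
  have "\<exists>f. ess_bounded f \<and> x = abs_linfty f"
    by (rule linfty.abs_induct[of _ x]) (auto simp: linfty_rel_def)
  then show ?thesis using that by blast
qed

lemma linfty_rel_refl: "linfty_rel f f \<longleftrightarrow> ess_bounded f"
  by (simp add: linfty_rel_def)

lemma abs_linfty_eqI:
  assumes "ess_bounded f" "ess_bounded g" "AE z in circle_measure. f z = g z"
  shows "abs_linfty f = abs_linfty g"
  using assms Quotient3_rel[OF Quotient3_linfty, of f g] by (simp add: linfty_rel_def)

lemma abs_linfty_zero: "0 = abs_linfty (\<lambda>_. 0)" by (simp add: zero_linfty_def)
lemma abs_linfty_one: "1 = abs_linfty (\<lambda>_. 1)" by (simp add: one_linfty_def)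

lemma abs_linfty_add:
  "ess_bounded f \<Longrightarrow> ess_bounded g \<Longrightarrow> abs_linfty f + abs_linfty g = abs_linfty (\<lambda>z. f z + g z)"
  by (simp add: plus_linfty.abs_eq linfty_rel_refl)

lemma abs_linfty_diff:
  "ess_bounded f \<Longrightarrow> ess_bounded g \<Longrightarrow> abs_linfty f - abs_linfty g = abs_linfty (\<lambda>z. f z - g z)"
  by (simp add: minus_linfty.abs_eq linfty_rel_refl)

lemma abs_linfty_mult:
  "ess_bounded f \<Longrightarrow> ess_bounded g \<Longrightarrow> abs_linfty f * abs_linfty g = abs_linfty (\<lambda>z. f z * g z)"
  by (simp add: times_linfty.abs_eq linfty_rel_refl)

lemma abs_linfty_scaleC:
  "ess_bounded f \<Longrightarrow> c *\<^sub>C abs_linfty f = abs_linfty (\<lambda>z. c * f z)"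
  by (simp add: scaleC_linfty.abs_eq linfty_rel_refl)

lemma norm_abs_linfty: "ess_bounded f \<Longrightarrow> norm (abs_linfty f) = ess_norm f"
  by (simp add: norm_linfty.abs_eq linfty_rel_refl)

lemma norm_abs_linfty_le:
  "ess_bounded f \<Longrightarrow> AE z in circle_measure. cmod (f z) \<le> C \<Longrightarrow> norm (abs_linfty f) \<le> C"
  by (simp add: norm_abs_linfty ess_norm_le)

lemma norm_abs_linfty_AE:
  "ess_bounded f \<Longrightarrow> AE z in circle_measure. cmod (f z) \<le> norm (abs_linfty f)"
  by (simp add: norm_abs_linfty ess_norm_AE)

lemma ess_boundedI:
  "f \<in> borel_measurable circle_measure \<Longrightarrow> AE z in circle_measure. cmod (f z) \<le> C \<Longrightarrow> ess_bounded f"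
  by (auto simp: ess_bounded_def)

lemma ess_bounded_poly: "ess_bounded (poly q)"
  by (rule poly_limit_ess_bounded) simp

lemma integrable_ess_bounded: "ess_bounded f \<Longrightarrow> integrable circle_measure f"
  by (auto simp: ess_bounded_def intro: integrable_circle_bounded)

lemma ess_bounded_power: "ess_bounded (\<lambda>z. z ^ k)"
  using ess_bounded_poly[of "monom 1 k"] by (simp add: poly_monom[abs_def])

lemma abs_linfty_in_hinfty_iff:
  assumes "ess_bounded f"
  shows "abs_linfty f \<in> hinfty \<longleftrightarrow> (\<forall>k>0. (LINT z|circle_measure. f z * z ^ k) = 0)"
proof -
  have "fourier_coeff (abs_linfty f) n = (LINT z|circle_measure. f z * z powi (- n))" for n
    using assms by (simp add: fourier_coeff.abs_eq linfty_rel_refl)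
  moreover have "(\<forall>n<0. (LINT z|circle_measure. f z * z powi (- n)) = 0) \<longleftrightarrow>
      (\<forall>k>0. (LINT z|circle_measure. f z * z ^ k) = 0)" (is "?l \<longleftrightarrow> ?r")
  proof
    assume l: ?l
    show ?r
    proof (intro allI impI)
      fix k :: nat assume "k > 0"
      then show "(LINT z|circle_measure. f z * z ^ k) = 0"
        using l[rule_format, of "- int k"] by simp
    qed
  next
    assume r: ?r
    show ?l
    proof (intro allI impI)
      fix n :: int assume "n < 0"
      then show "(LINT z|circle_measure. f z * z powi (- n)) = 0"
        using r[rule_format, of "nat (- n)"] by (simp add: power_int_def)
    qed
  qed
  ultimately show ?thesis by (simp add: hinfty_def)
qed

lemma poly_limit_in_hinfty: "poly_limit f \<Longrightarrow> abs_linfty f \<in> hinfty"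
  by (simp add: abs_linfty_in_hinfty_iff poly_limit_ess_bounded poly_limit_coeff)

lemma circle_AE: "AE z in circle_measure. cmod z = 1"
  by (rule AE_circleI)

text \<open>Made for infinite products: their partial products are bounded analytic, and dominated
  convergence preserves the vanishing of coefficients.\<close>

lemma hinfty_limit:
  assumes f: "f \<in> borel_measurable circle_measure"
    and s: "\<And>n. poly_limit (s n)" and C: "\<And>n. AE z in circle_measure. cmod (s n z) \<le> C"
    and lim: "AE z in circle_measure. (\<lambda>n. s n z) \<longlonglongrightarrow> f z"
  shows "abs_linfty f \<in> hinfty"
proof (subst abs_linfty_in_hinfty_iff)
  show "ess_bounded f"
    using f AE_bounded_limit[OF C lim] by (rule ess_boundedI)
  show "\<forall>k>0. (LINT z|circle_measure. f z * z ^ k) = 0"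
  proof (intro allI impI)
    fix k :: nat assume "k > 0"
    have [measurable]: "(\<lambda>z. z ^ k) \<in> borel_measurable circle_measure"
      by (auto intro!: borel_measurable_circleI continuous_intros)
    note [measurable] = f s[THEN poly_limit_measurable]
    have "(\<lambda>n. LINT z|circle_measure. s n z * z ^ k) \<longlonglongrightarrow> (LINT z|circle_measure. f z * z ^ k)"
    proof (rule integral_bounded_limit)
      show "AE z in circle_measure. cmod (s n z * z ^ k) \<le> C" for n
        using C[of n] circle_AE
        by eventually_elim (auto simp: norm_mult norm_power)
      show "AE z in circle_measure. (\<lambda>n. s n z * z ^ k) \<longlonglongrightarrow> f z * z ^ k"
        using lim by eventually_elim (intro tendsto_intros)
    qed measurable
    then show "(LINT z|circle_measure. f z * z ^ k) = 0"
      using poly_limit_coeff[OF s \<open>k > 0\<close>] by (simp add: LIMSEQ_const_iff)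
  qed
qed

section \<open>Closure properties of a fixed Douglas algebra\<close>

locale douglas =
  fixes D :: "linfty set"
  assumes douglas: "douglas_algebra D"
begin

lemma add: "f \<in> D \<Longrightarrow> g \<in> D \<Longrightarrow> f + g \<in> D"
  and mult: "f \<in> D \<Longrightarrow> g \<in> D \<Longrightarrow> f * g \<in> D"
  and scaleC: "f \<in> D \<Longrightarrow> c *\<^sub>C f \<in> D"
  and zero: "0 \<in> D"
  and hinfty: "f \<in> hinfty \<Longrightarrow> f \<in> D"
  using douglas by (auto simp: douglas_algebra_def csubalgebra_def)

lemma poly_limit: "poly_limit f \<Longrightarrow> abs_linfty f \<in> D"
  by (intro hinfty poly_limit_in_hinfty)

lemma one: "1 \<in> D"
  unfolding abs_linfty_one by (rule poly_limit) simp

lemma diff: "f \<in> D \<Longrightarrow> g \<in> D \<Longrightarrow> f - g \<in> D"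
proof -
  assume "f \<in> D" "g \<in> D"
  moreover have "g + (- 1) *\<^sub>C g = (1 + - 1) *\<^sub>C g"
    by (simp only: scaleC_add_left scaleC_one)
  moreover have "0 *\<^sub>C g = 0"
    using norm_scaleC[of 0 g] by simp
  ultimately have "(- 1) *\<^sub>C g = - g"
    by (simp add: eq_neg_iff_add_eq_0 add.commute)
  then show "f - g \<in> D"
    using add[OF \<open>f \<in> D\<close> scaleC[OF \<open>g \<in> D\<close>, of "- 1"]] by simp
qed

lemma power: "f \<in> D \<Longrightarrow> f ^ n \<in> D"
  by (induction n) (auto simp: one mult)

lemma sum: "(\<And>i. i \<in> A \<Longrightarrow> f i \<in> D) \<Longrightarrow> sum f A \<in> D"
  by (induction A rule: infinite_finite_induct) (auto simp: zero add)

lemma prod: "(\<And>i. i \<in> A \<Longrightarrow> f i \<in> D) \<Longrightarrow> prod f A \<in> D"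
  by (induction A rule: infinite_finite_induct) (auto simp: one mult)

lemma approx:
  assumes "\<And>e. e > 0 \<Longrightarrow> \<exists>g\<in>D. norm (f - g) \<le> e"
  shows "f \<in> D"
proof -
  have "closed D" using douglas by (simp add: douglas_algebra_def)
  moreover have "\<exists>g\<in>D. dist g f < e" if "e > 0" for e
    using assms[of "e / 2"] that by (force simp: dist_norm norm_minus_commute)
  ultimately show ?thesis using closed_approachable by blast
qed

text \<open>The inverse exists pointwise as \<open>inverse (1 - f z)\<close> and is essentially
  bounded because \<open>norm a < 1\<close>. It lies in the closed set \<open>D\<close> because the
  partial geometric sums do and differ from it by \<open>b * a ^ n\<close>.\<close>

lemma neumann:
  assumes "a \<in> D" "norm a < 1"
  obtains b where "b \<in> D" "b * (1 - a) = 1"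
proof -
  obtain f where f: "ess_bounded f" "a = abs_linfty f" by (rule abs_linfty_cases)
  define r where "r = norm a"
  have fr: "AE z in circle_measure. cmod (f z) \<le> r"
    using norm_abs_linfty_AE[OF f(1)] f(2) by (simp add: r_def)
  have bound: "1 - r \<le> cmod (1 - w)" if "cmod w \<le> r" for w
    using norm_triangle_ineq2[of 1 w] that by simp
  have g: "ess_bounded (\<lambda>z. inverse (1 - f z))"
  proof (rule ess_boundedI)
    show "(\<lambda>z. inverse (1 - f z)) \<in> borel_measurable circle_measure"
      using ess_boundedD[OF f(1)] by measurable
    show "AE z in circle_measure. cmod (inverse (1 - f z)) \<le> inverse (1 - r)"
      using fr
    proof eventually_elim
      case (elim z)
      then show ?case
        using bound[OF elim] assms(2) by (auto simp: r_def norm_inverse intro!: le_imp_inverse_le)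
    qed
  qed
  define b where "b = abs_linfty (\<lambda>z. inverse (1 - f z))"
  have inv: "b * (1 - a) = 1"
    unfolding b_def f(2) abs_linfty_one using f(1) g
  proof (simp add: abs_linfty_diff abs_linfty_mult ess_bounded_const ess_bounded_diff)
    show "abs_linfty (\<lambda>z. inverse (1 - f z) * (1 - f z)) = abs_linfty (\<lambda>_. 1)"
    proof (rule abs_linfty_eqI)
      show "AE z in circle_measure. inverse (1 - f z) * (1 - f z) = 1"
        using fr
      proof eventually_elim
        case (elim z)
        then have "f z \<noteq> 1" using assms(2) by (auto simp: r_def)
        then show ?case by simp
      qed
    qed (intro ess_bounded_mult ess_bounded_diff ess_bounded_const f g)+
  qed
  have "b \<in> D"
  proof (rule approx)
    fix e :: real assume "e > 0"
    have "(\<lambda>n. norm b * r ^ n) \<longlonglongrightarrow> norm b * 0"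
      using assms(2) by (intro tendsto_mult tendsto_const LIMSEQ_power_zero) (simp add: r_def)
    then have "\<forall>\<^sub>F n in sequentially. norm b * r ^ n < e"
      using \<open>e > 0\<close> by (intro order_tendstoD(2)) auto
    then obtain n where n: "norm b * r ^ n < e"
      by (auto dest: eventually_happens)
    have "(\<Sum>k<n. a ^ k) = b * ((1 - a) * (\<Sum>k<n. a ^ k))"
      by (simp only: mult.assoc[symmetric] inv mult_1)
    then have "b - (\<Sum>k<n. a ^ k) = b * (1 - (1 - a) * (\<Sum>k<n. a ^ k))"
      by (simp only: right_diff_distrib mult_1_right)
    also have "(1 - a) * (\<Sum>k<n. a ^ k) = 1 - a ^ n"
      by (simp add: one_diff_power_eq)
    finally have "b - (\<Sum>k<n. a ^ k) = b * a ^ n" by simp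
    then have "norm (b - (\<Sum>k<n. a ^ k)) \<le> norm b * r ^ n"
      unfolding r_def
      by (simp only: order_trans[OF norm_mult_ineq mult_left_mono[OF norm_power_ineq norm_ge_zero]])
    with n show "\<exists>g\<in>D. norm (b - g) \<le> e"
      by (intro bexI[of _ "\<Sum>k<n. a ^ k"] sum power assms) auto
  qed
  with inv show ?thesis by (rule that[rotated])
qed

end

section \<open>Inner multipliers\<close>

text \<open>For a unimodular number, \<open>(cmod (c - 1))\<^sup>2 = 2 - 2 * Re c\<close>, so a mean
  close to 1 forces closeness in \<open>L^1\<close>; the weight \<open>1 / \<epsilon>\<close>
  balances the two halves of the bound.\<close>

lemma unimodular_L1_le:
  assumes c: "c \<in> borel_measurable circle_measure" "AE z in circle_measure. cmod (c z) = 1"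
    and "\<epsilon> > 0" and mean: "1 - \<epsilon>\<^sup>2 / 2 \<le> Re (integral\<^sup>L circle_measure c)"
  shows "(LINT z|circle_measure. cmod (c z - 1)) \<le> \<epsilon>"
proof -
  note [measurable] = c(1)
  have i: "integrable circle_measure c"
    using c by (intro integrable_circle_bounded[of _ 1]) (auto elim: eventually_mono)
  have "(LINT z|circle_measure. cmod (c z - 1)) \<le>
      (LINT z|circle_measure. \<epsilon> / 2 + (1 - Re (c z)) / \<epsilon>)"
  proof (rule integral_mono_AE)
    show "AE z in circle_measure. cmod (c z - 1) \<le> \<epsilon> / 2 + (1 - Re (c z)) / \<epsilon>"
      using c(2)
    proof eventually_elim
      case (elim z)
      have "(cmod (c z - 1))\<^sup>2 = (cmod (c z))\<^sup>2 + 1 - 2 * Re (c z)"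
        by (simp only: cmod_power2) (simp add: power2_eq_square algebra_simps)
      then have "(cmod (c z - 1))\<^sup>2 = 2 - 2 * Re (c z)"
        by (simp add: elim)
      moreover have "\<bar>cmod (c z - 1)\<bar> \<le> (1 / (1 / \<epsilon>) + (1 / \<epsilon>) * (cmod (c z - 1))\<^sup>2) / 2"
        using \<open>\<epsilon> > 0\<close> by (intro abs_le_weighted_square) simp
      ultimately show ?case using \<open>\<epsilon> > 0\<close> by (simp add: field_simps)
    qed
  qed (use i in auto)
  also have "\<dots> = \<epsilon> / 2 + (1 - Re (integral\<^sup>L circle_measure c)) / \<epsilon>"
    using i by (simp add: circle.prob_space)
  also have "\<dots> \<le> \<epsilon> / 2 + (\<epsilon>\<^sup>2 / 2) / \<epsilon>"
    using mean \<open>\<epsilon> > 0\<close> by (intro add_left_mono divide_right_mono) auto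
  also have "\<dots> = \<epsilon>" using \<open>\<epsilon> > 0\<close> by (simp add: power2_eq_square)
  finally show ?thesis .
qed

text \<open>Here \<open>h / c = exp G / (1 + exp G)\<close> is uniformly close to
  \<open>indicator E\<close>, and \<open>H\<close> has real part
  \<open>ln (cmod (1 + exp G))\<close>, which makes \<open>c\<close> unimodular. By multiplicativity
  the mean of \<open>c\<close> is at least \<open>exp (- mean u)\<close>. Since \<open>u\<close> is
  at most about \<open>n\<close> on \<open>E\<close> and at most \<open>m\<close> elsewhere, its
  mean is small once \<open>E\<close> is small compared with \<open>1 / n\<close>.\<close>

lemma small_set_multiplier:
  fixes \<epsilon> :: real
  assumes "\<epsilon> > 0"
  shows "\<exists>\<eta>>0. \<forall>E\<in>sets circle_measure. measure circle_measure E < \<eta> \<longrightarrow>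
    (\<exists>c h. poly_limit c \<and> poly_limit h \<and> (AE z in circle_measure. cmod (c z) = 1) \<and>
      (LINT z|circle_measure. cmod (c z - 1)) \<le> \<epsilon> \<and>
      (AE z in circle_measure. cmod (c z * indicator E z - h z) \<le> \<epsilon>))"
proof -
  \<comment> \<open>The bound \<open>1/2\<close> keeps \<open>1 + exp G\<close> away from 0,
    \<open>\<epsilon> / 2\<close> serves the uniform estimate \<open>2 * m \<le> \<epsilon>\<close>,
    and \<open>\<epsilon>\<^sup>2 / 4\<close> is half of the allowance
    \<open>\<epsilon>\<^sup>2 / 2\<close> for the mean of \<open>u\<close>.\<close>
  define m where "m = min (1/2) (min (\<epsilon> / 2) (\<epsilon>\<^sup>2 / 4))"
  have m: "m > 0" "m \<le> 1/2" "m \<le> \<epsilon> / 2" "m \<le> \<epsilon>\<^sup>2 / 4"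
    using assms by (auto simp: m_def)
  define n where "n = - ln m"
  have n: "exp n = 1 / m" "exp (- n) = m" "n \<ge> 0"
    using m by (auto simp: n_def exp_minus field_simps)
  show ?thesis
  \<comment> \<open>The other half of that allowance:
    \<open>(n + 1) * measure circle_measure E\<close> stays below
    \<open>\<epsilon>\<^sup>2 / 4\<close>.\<close>
  proof (intro exI[of _ "\<epsilon>\<^sup>2 / (4 * (n + 1))"] conjI ballI impI)
    show "\<epsilon>\<^sup>2 / (4 * (n + 1)) > 0" using assms n by simp
    fix E assume E [measurable]: "E \<in> sets circle_measure"
      and small: "measure circle_measure E < \<epsilon>\<^sup>2 / (4 * (n + 1))"
    define w where "w z = n * (2 * indicator E z - 1)" for z
    have "w \<in> borel_measurable circle_measure" unfolding w_def by measurable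
    moreover have "\<bar>w z\<bar> \<le> n" for z
      using n(3) by (auto simp: w_def indicator_def)
    ultimately obtain G where G: "G \<in> borel_measurable circle_measure" "AE z in circle_measure. Re (G z) = w z"
        "poly_limit (\<lambda>z. exp (G z))"
        "(LINT z|circle_measure. exp (G z)) = of_real (exp (LINT z|circle_measure. w z))"
      using outer_function_exists by metis
    note [measurable] = G(1)
    \<comment> \<open>The cut-off gives the bound at every point that
      \<open>outer_function_exists\<close> demands. It is inactive almost everywhere, because there
      \<open>cmod (1 + exp (G z))\<close> lies between \<open>1 / 2\<close> and
      \<open>exp (n + 1)\<close>.\<close>
    define u where "u z = max (- 1) (min (n + 1) (ln (cmod (1 + exp (G z)))))" for z
    have um [measurable]: "u \<in> borel_measurable circle_measure" unfolding u_def by measurable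
    have ub: "\<bar>u z\<bar> \<le> n + 1" for z
      using n(3) by (auto simp: u_def)
    obtain H where H: "H \<in> borel_measurable circle_measure" "AE z in circle_measure. Re (H z) = u z"
        "poly_limit (\<lambda>z. exp (- H z))"
        "(LINT z|circle_measure. exp (- H z)) = of_real (exp (- (LINT z|circle_measure. u z)))"
      using outer_function_exists[OF um ub] by metis
    have k: "AE z in circle_measure. cmod (exp (G z)) = (if z \<in> E then 1 / m else m)"
      using G(2) by eventually_elim (auto simp: w_def n)
    have bounds: "(if z \<in> E then 1 / m - 1 else 1 - m) \<le> cmod (1 + exp (G z))"
      "cmod (1 + exp (G z)) \<le> (if z \<in> E then 1 / m + 1 else 1 + m)" "cmod (1 + exp (G z)) \<ge> 1 / 2"
      if "cmod (exp (G z)) = (if z \<in> E then 1 / m else m)" for z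
    proof -
      have "cmod (1 + exp (G z)) \<le> 1 + cmod (exp (G z))"
        using norm_triangle_ineq[of 1 "exp (G z)"] by simp
      then show "cmod (1 + exp (G z)) \<le> (if z \<in> E then 1 / m + 1 else 1 + m)"
        using that by (auto split: if_splits)
      have "cmod (1 + exp (G z)) \<ge> 1 - cmod (exp (G z))" "cmod (1 + exp (G z)) \<ge> cmod (exp (G z)) - 1"
        using norm_diff_ineq[of 1 "exp (G z)"] norm_diff_ineq[of "exp (G z)" 1] by (simp_all add: add.commute)
      then show *: "(if z \<in> E then 1 / m - 1 else 1 - m) \<le> cmod (1 + exp (G z))"
        using that by (auto split: if_splits)
      have "1 / m \<ge> 2" using m by (simp add: field_simps)
      with * m(2) show "cmod (1 + exp (G z)) \<ge> 1 / 2"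
        by (auto split: if_splits)
    qed
    have e1: "exp 1 \<ge> (2::real)" using exp_ge_add_one_self[of 1] by simp
    have u_eq: "u z = ln (cmod (1 + exp (G z)))" "u z \<le> (n + 1) * indicator E z + m"
      if "cmod (exp (G z)) = (if z \<in> E then 1 / m else m)" for z
    proof -
      note b = bounds[OF that]
      have pos: "cmod (1 + exp (G z)) > 0" using b(3) by linarith
      have "exp (- 1) \<le> (1 / 2 :: real)" using e1 by (simp add: exp_minus field_simps)
      then have "- 1 \<le> ln (cmod (1 + exp (G z)))"
        using b(3) pos by (subst ln_ge_iff) auto
      moreover have le: "ln (cmod (1 + exp (G z))) \<le> (if z \<in> E then n + 1 else m)"
      proof (cases "z \<in> E")
        case True
        have "1 / m + 1 \<le> 1 / m * 2" using m by (simp add: field_simps)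
        also have "\<dots> \<le> exp n * exp 1" using e1 m unfolding n(1) by (intro mult_left_mono) auto
        finally have "cmod (1 + exp (G z)) \<le> exp (n + 1)"
          using b(2) True by (simp add: exp_add)
        then have "ln (cmod (1 + exp (G z))) \<le> ln (exp (n + 1))"
          using pos by (subst ln_le_cancel_iff) auto
        then show ?thesis using True by simp
      next
        case False
        then have "ln (cmod (1 + exp (G z))) \<le> ln (1 + m)"
          using b(2) pos m by (subst ln_le_cancel_iff) auto
        also have "\<dots> \<le> m" using m by (intro ln_add_one_self_le_self) simp
        finally show ?thesis using False by simp
      qed
      ultimately show "u z = ln (cmod (1 + exp (G z)))" "u z \<le> (n + 1) * indicator E z + m"
        using m n(3) by (auto simp: u_def split: if_splits)
    qed
    define c where "c z = (1 + exp (G z)) * exp (- H z)" for z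
    define h where "h z = exp (G z) * exp (- H z)" for z
    have Pc: "poly_limit c" and Ph: "poly_limit h"
      unfolding c_def h_def by (intro poly_limit_mult poly_limit_add poly_limit_const G H)+
    note [measurable] = poly_limit_measurable[OF Pc]
    have expH: "AE z in circle_measure. cmod (exp (- H z)) = 1 / cmod (1 + exp (G z))"
      using k H(2)
    proof eventually_elim
      case (elim z)
      have "cmod (1 + exp (G z)) > 0" using bounds(3)[OF elim(1)] by linarith
      then have "exp (- Re (H z)) = 1 / cmod (1 + exp (G z))"
        by (simp add: elim(2) u_eq(1)[OF elim(1)] exp_minus divide_inverse)
      then show ?case by (simp only: norm_exp_eq_Re uminus_complex.sel)
    qed
    have unimod: "AE z in circle_measure. cmod (c z) = 1"
      using expH k
    proof eventually_elim
      case (elim z)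
      have "1 + exp (G z) \<noteq> 0" using bounds(3)[OF elim(2)] by auto
      then show ?case
        by (simp add: c_def norm_mult elim(1) del: norm_exp_eq_Re)
    qed
    have iu: "integrable circle_measure u"
      using ub um by (intro integrable_circle_bounded[of _ "n + 1"]) auto
    have "(LINT z|circle_measure. u z) \<le> (LINT z|circle_measure. (n + 1) * indicator E z + m)"
    proof (rule integral_mono_AE[OF iu])
      show "AE z in circle_measure. u z \<le> (n + 1) * indicator E z + m"
        using k by eventually_elim (rule u_eq(2))
    qed (auto simp: circle.emeasure_eq_measure)
    also have "\<dots> = (n + 1) * measure circle_measure E + m"
      by (simp add: circle.prob_space circle.emeasure_eq_measure)
    also have "\<dots> \<le> (n + 1) * (\<epsilon>\<^sup>2 / (4 * (n + 1))) + \<epsilon>\<^sup>2 / 4"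
      using small n(3) m(4) by (intro add_mono mult_left_mono) auto
    also have "\<dots> = \<epsilon>\<^sup>2 / 2" using n(3) by (simp add: field_simps)
    finally have int_u: "(LINT z|circle_measure. u z) \<le> \<epsilon>\<^sup>2 / 2" .
    have iG: "integrable circle_measure (\<lambda>z. exp (G z))"
      using poly_limit_ess_bounded[OF G(3)] by (rule integrable_ess_bounded)
    have "integral\<^sup>L circle_measure c =
        (LINT z|circle_measure. 1 + exp (G z)) * (LINT z|circle_measure. exp (- H z))"
      unfolding c_def by (intro poly_limit_mult poly_limit_add poly_limit_const G H)
    also have "\<dots> = of_real ((1 + exp (LINT z|circle_measure. w z)) * exp (- (LINT z|circle_measure. u z)))"
      using iG by (simp add: G H circle.prob_space)
    finally have "Re (integral\<^sup>L circle_measure c) =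
        (1 + exp (LINT z|circle_measure. w z)) * exp (- (LINT z|circle_measure. u z))"
      by simp
    also have "\<dots> \<ge> 1 * exp (- (LINT z|circle_measure. u z))"
      by (intro mult_right_mono) auto
    also have "1 * exp (- (LINT z|circle_measure. u z)) \<ge> 1 - \<epsilon>\<^sup>2 / 2"
      using int_u exp_ge_add_one_self[of "- (LINT z|circle_measure. u z)"] by simp
    finally have "(LINT z|circle_measure. cmod (c z - 1)) \<le> \<epsilon>"
      using unimod assms by (intro unimodular_L1_le) auto
    moreover have "AE z in circle_measure. cmod (c z * indicator E z - h z) \<le> \<epsilon>"
      using expH k
    proof eventually_elim
      case (elim z)
      \<comment> \<open>The difference is \<open>exp (- H)\<close> on \<open>E\<close>, where the
        denominator \<open>1 + exp G\<close> is large, and \<open>- exp G * exp (- H)\<close> off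
        \<open>E\<close>, where the numerator is small.\<close>
      have "c z * indicator E z - h z = (indicator E z - (1 - indicator E z) * exp (G z)) * exp (- H z)"
        by (simp add: c_def h_def indicator_def algebra_simps)
      then have *: "cmod (c z * indicator E z - h z) = (if z \<in> E then 1 else m) / cmod (1 + exp (G z))"
        using elim by (simp add: norm_mult del: norm_exp_eq_Re)
      also have "\<dots> \<le> 2 * m"
      proof (cases "z \<in> E")
        case True
        have "1 / (2 * m) \<le> 1 / m - 1" using m by (simp add: field_simps)
        also have "\<dots> \<le> cmod (1 + exp (G z))" using bounds(1)[OF elim(2)] True by simp
        finally have "1 \<le> cmod (1 + exp (G z)) * (2 * m)" using m by (simp add: pos_divide_le_eq)
        moreover have "cmod (1 + exp (G z)) > 0" using bounds(3)[OF elim(2)] by linarith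
        ultimately show ?thesis using True by (simp add: pos_divide_le_eq mult_ac)
      next
        case False
        have "m * 1 \<le> m * (2 * cmod (1 + exp (G z)))"
          using bounds(3)[OF elim(2)] m by (intro mult_left_mono) auto
        with False show ?thesis
          using bounds(3)[OF elim(2)] m by (simp add: divide_le_eq mult_ac)
      qed
      also have "\<dots> \<le> \<epsilon>" using m by simp
      finally show ?case .
    qed
    ultimately show "\<exists>c h. poly_limit c \<and> poly_limit h \<and> (AE z in circle_measure. cmod (c z) = 1) \<and>
        (LINT z|circle_measure. cmod (c z - 1)) \<le> \<epsilon> \<and>
        (AE z in circle_measure. cmod (c z * indicator E z - h z) \<le> \<epsilon>)"
      using Pc Ph unimod by blast
  qed
qed

section \<open>The conjugate of z\<close>

context douglas
begin

lemma abs_linfty_zbar: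
  "abs_linfty (\<lambda>z. inverse z) * abs_linfty (\<lambda>z. z) = 1" "ess_bounded inverse" "ess_bounded (\<lambda>z. z)"
proof -
  show 1: "ess_bounded (\<lambda>z. z)" using ess_bounded_power[of 1] by simp
  have "continuous_on (sphere 0 1) (inverse :: complex \<Rightarrow> complex)" by (intro continuous_intros) auto
  then show 2: "ess_bounded inverse"
    by (intro ess_boundedI[of _ 1] borel_measurable_circleI AE_circleI) (auto simp: norm_inverse)
  show "abs_linfty (\<lambda>z. inverse z) * abs_linfty (\<lambda>z. z) = 1"
    unfolding abs_linfty_one abs_linfty_mult[OF 2 1]
    by (intro abs_linfty_eqI ess_bounded_mult ess_bounded_const 1 2 AE_circleI)
      (metis left_inverse norm_zero zero_neq_one)
qed

text \<open>If \<open>F \<in> z D\<close> has mean \<open>-1\<close>, then \<open>(1 + t F) exp G\<close> with an outer function \<open>exp G\<close> of modulus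
  \<open>exp (- t Re F - t)\<close> and mean \<open>1\<close> lies in \<open>1 + z D\<close> and has norm less than \<open>1\<close>, for small \<open>t\<close>.
  So \<open>z D\<close> contains an invertible element of \<open>D\<close>.\<close>

lemma zbar_in: "abs_linfty inverse \<in> D"
proof -
  define Z where "Z = abs_linfty (\<lambda>z. z)"
  have Z: "Z \<in> D"
  proof -
    have "poly [:0, 1:] = (\<lambda>z::complex. z)" by (simp add: fun_eq_iff)
    then show ?thesis unfolding Z_def by (metis poly_limit poly_limit_poly)
  qed
  have Zpow: "Z ^ k = abs_linfty (\<lambda>z. z ^ k)" for k
    by (induction k) (simp_all add: abs_linfty_one Z_def abs_linfty_mult ess_bounded_power abs_linfty_zbar)
  \<comment> \<open>Strictness of the inclusion supplies an element with a nonzero coefficient of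
    negative index \<open>- k\<close>; multiplying by \<open>z ^ k\<close> moves it to the mean, and
    \<open>k > 0\<close> leaves a factor \<open>Z\<close>.\<close>
  obtain f where f: "ess_bounded f" "abs_linfty f \<in> D" "abs_linfty f \<notin> hinfty"
    using douglas unfolding douglas_algebra_def by (metis abs_linfty_cases psubset_imp_ex_mem DiffE)
  then obtain k where k: "k > 0" "(LINT z|circle_measure. f z * z ^ k) \<noteq> 0"
    by (auto simp: abs_linfty_in_hinfty_iff)
  define a where "a = - 1 / (LINT z|circle_measure. f z * z ^ k)"
  define F where "F z = a * (f z * z ^ k)" for z
  have F: "ess_bounded F"
    unfolding F_def by (intro ess_bounded_mult ess_bounded_const f ess_bounded_power)
  note [measurable] = ess_boundedD[OF F]
  have iF: "integrable circle_measure F" using F by (rule integrable_ess_bounded)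
  have meanF: "integral\<^sup>L circle_measure F = - 1"
    using k(2) unfolding F_def by (simp add: a_def)
  have LF: "abs_linfty F = Z * (a *\<^sub>C (abs_linfty f * Z ^ (k - 1)))"
  proof -
    have "abs_linfty F = a *\<^sub>C (abs_linfty f * Z ^ k)"
      unfolding F_def Zpow
      by (simp add: abs_linfty_mult abs_linfty_scaleC f ess_bounded_power ess_bounded_mult)
    also have "Z ^ k = Z * Z ^ (k - 1)"
      using k(1) by (simp add: power_eq_if)
    finally show ?thesis by (metis mult.left_commute mult.commute mult_scaleC_left)
  qed
  define M where "M = norm (abs_linfty F) + 1"
  have M: "M > 0" "AE z in circle_measure. cmod (F z) \<le> M"
  proof -
    show "M > 0" by (simp add: M_def add_nonneg_pos)
    show "AE z in circle_measure. cmod (F z) \<le> M"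
      using norm_abs_linfty_AE[OF F] by eventually_elim (simp add: M_def)
  qed
  \<comment> \<open>Small enough that the quadratic term
    \<open>t\<^sup>2 * (cmod (F z))\<^sup>2\<close> is at most \<open>t\<close>, which the mean of
    \<open>w\<close> compensates.\<close>
  define t where "t = 1 / M\<^sup>2"
  have t: "t > 0" "t\<^sup>2 * M\<^sup>2 = t" using M(1) by (simp_all add: t_def power2_eq_square)
  define w where "w z = - t * max (- M) (min M (Re (F z)))" for z
  have wm: "w \<in> borel_measurable circle_measure" unfolding w_def by measurable
  have wb: "\<bar>w z\<bar> \<le> t * M" for z
    unfolding w_def using t(1) M(1) by (auto simp: abs_mult)
  have w: "AE z in circle_measure. w z = - t * Re (F z)"
    using M(2)
  proof eventually_elim
    case (elim z)
    then have "\<bar>Re (F z)\<bar> \<le> M" using abs_Re_le_cmod order_trans by blast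
    then show ?case by (simp add: w_def max_def min_def abs_le_iff)
  qed
  have int_w: "(LINT z|circle_measure. w z) = t"
  proof -
    have "(LINT z|circle_measure. w z) = (LINT z|circle_measure. - t * Re (F z))"
      using w wm by (intro integral_cong_AE) auto
    also have "\<dots> = - t * Re (integral\<^sup>L circle_measure F)"
      using iF by simp
    finally show ?thesis by (simp add: meanF)
  qed
  obtain G where G: "G \<in> borel_measurable circle_measure" "AE z in circle_measure. Re (G z) = w z"
      "poly_limit (\<lambda>z. exp (G z))"
      "(LINT z|circle_measure. exp (G z)) = of_real (exp (LINT z|circle_measure. w z))"
    using outer_function_exists[OF wm wb] by metis
  define \<kappa> where "\<kappa> z = exp (G z) * of_real (exp (- t))" for z
  have P\<kappa>: "poly_limit \<kappa>"
    unfolding \<kappa>_def by (intro poly_limit_mult poly_limit_const G)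
  have \<kappa>: "ess_bounded \<kappa>" using P\<kappa> by (rule poly_limit_ess_bounded)
  have mean\<kappa>: "integral\<^sup>L circle_measure \<kappa> = 1"
    unfolding \<kappa>_def using G(4) int_w by (simp add: exp_minus)
  define \<kappa>1 where "\<kappa>1 z = (\<kappa> z - 1) * inverse z" for z
  have \<kappa>1: "ess_bounded \<kappa>1"
    unfolding \<kappa>1_def by (intro ess_bounded_mult ess_bounded_diff ess_bounded_const \<kappa> abs_linfty_zbar)
  \<comment> \<open>Division by \<open>z\<close> shifts the coefficients by one. The only new
    condition is \<open>j = 1\<close>, and it says that \<open>\<kappa> - 1\<close> has mean
    0.\<close>
  have "abs_linfty \<kappa>1 \<in> hinfty"
  proof (subst abs_linfty_in_hinfty_iff[OF \<kappa>1], intro allI impI)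
    fix j :: nat assume "j > 0"
    have P: "poly_limit (\<lambda>z. \<kappa> z - 1)"
      using poly_limit_add[OF P\<kappa> poly_limit_const[of "- 1"]] by simp
    have "(LINT z|circle_measure. \<kappa>1 z * z ^ j) = (LINT z|circle_measure. (\<kappa> z - 1) * z ^ (j - 1))"
    proof (rule Bochner_Integration.integral_cong)
      fix z assume "z \<in> space circle_measure"
      then have "z \<noteq> 0" by (auto simp: space_circle_measure)
      with \<open>j > 0\<close> show "\<kappa>1 z * z ^ j = (\<kappa> z - 1) * z ^ (j - 1)"
        by (cases j) (auto simp: \<kappa>1_def)
    qed simp
    also have "\<dots> = 0"
    proof (cases "j = 1")
      case True
      then show ?thesis
        using integrable_ess_bounded[OF \<kappa>] mean\<kappa> by (simp add: circle.prob_space)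
    next
      case False
      with \<open>j > 0\<close> show ?thesis by (intro poly_limit_coeff P) auto
    qed
    finally show "(LINT z|circle_measure. \<kappa>1 z * z ^ j) = 0" .
  qed
  then have K1: "abs_linfty \<kappa>1 \<in> D" by (rule hinfty)
  have K: "abs_linfty \<kappa> = 1 + Z * abs_linfty \<kappa>1"
  proof -
    have "1 + Z * abs_linfty \<kappa>1 = abs_linfty (\<lambda>z. 1 + z * \<kappa>1 z)"
      unfolding Z_def abs_linfty_one
      by (simp add: abs_linfty_mult abs_linfty_add abs_linfty_zbar \<kappa>1 ess_bounded_const ess_bounded_mult)
    also have "\<dots> = abs_linfty \<kappa>"
    proof (intro abs_linfty_eqI ess_bounded_add ess_bounded_const ess_bounded_mult \<kappa> \<kappa>1 abs_linfty_zbar)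
      show "AE z in circle_measure. 1 + z * \<kappa>1 z = \<kappa> z"
      proof (rule AE_circleI)
        fix z :: complex assume "cmod z = 1"
        then have "z \<noteq> 0" by auto
        then show "1 + z * \<kappa>1 z = \<kappa> z" by (simp add: \<kappa>1_def field_simps)
      qed
    qed
    finally show ?thesis by simp
  qed
  define Y where "Y = (1 + of_real t *\<^sub>C abs_linfty F) * abs_linfty \<kappa>"
  \<comment> \<open>Solves \<open>1 - Y = Z * d\<close>: both \<open>F\<close> and
    \<open>\<kappa> - 1\<close> carry a factor \<open>Z\<close>.\<close>
  define d where "d = - (of_real t *\<^sub>C (a *\<^sub>C (abs_linfty f * Z ^ (k - 1))) * abs_linfty \<kappa> + abs_linfty \<kappa>1)"
  have d: "d \<in> D"
  proof -
    have "0 - (of_real t *\<^sub>C (a *\<^sub>C (abs_linfty f * Z ^ (k - 1))) * abs_linfty \<kappa> + abs_linfty \<kappa>1) \<in> D"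
      by (intro diff zero add mult scaleC f power Z K1 poly_limit P\<kappa>)
    then show ?thesis by (simp add: d_def)
  qed
  have Yd: "1 - Y = Z * d"
  proof -
    have "of_real t *\<^sub>C abs_linfty F = Z * (of_real t *\<^sub>C (a *\<^sub>C (abs_linfty f * Z ^ (k - 1))))"
      unfolding LF by (metis mult.commute mult_scaleC_left)
    then have "Y = abs_linfty \<kappa> + Z * (of_real t *\<^sub>C (a *\<^sub>C (abs_linfty f * Z ^ (k - 1)))) * abs_linfty \<kappa>"
      by (simp add: Y_def algebra_simps)
    also have "abs_linfty \<kappa> + Z * (of_real t *\<^sub>C (a *\<^sub>C (abs_linfty f * Z ^ (k - 1)))) * abs_linfty \<kappa> = 1 - Z * d"
      unfolding d_def by (subst K) (simp add: algebra_simps)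
    finally show ?thesis by simp
  qed
  have YD: "Y \<in> D"
    unfolding Y_def LF by (intro add mult scaleC one Z f power poly_limit P\<kappa>)
  have "norm Y \<le> exp (- t / 2)"
  proof -
    have Y: "Y = abs_linfty (\<lambda>z. (1 + of_real t * F z) * \<kappa> z)"
      unfolding Y_def abs_linfty_one using F \<kappa>
      by (simp add: abs_linfty_scaleC abs_linfty_add abs_linfty_mult ess_bounded_const ess_bounded_mult
          ess_bounded_add)
    show ?thesis
      unfolding Y
    proof (rule norm_abs_linfty_le)
      show "ess_bounded (\<lambda>z. (1 + of_real t * F z) * \<kappa> z)"
        by (intro ess_bounded_mult ess_bounded_add ess_bounded_const F \<kappa>)
      show "AE z in circle_measure. cmod ((1 + of_real t * F z) * \<kappa> z) \<le> exp (- t / 2)"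
        using M(2) w G(2)
      proof eventually_elim
        case (elim z)
        \<comment> \<open>To first order \<open>1 + t F\<close> has modulus
          \<open>exp (t * Re F)\<close>, which \<open>\<kappa>\<close> cancels. The second-order
          excess is at most \<open>exp (t / 2)\<close>, while \<open>\<kappa>\<close> gains
          \<open>exp (- t)\<close>.\<close>
        have "(cmod (1 + of_real t * F z))\<^sup>2 = 1 + (2 * t * Re (F z) + t\<^sup>2 * (cmod (F z))\<^sup>2)"
          by (simp only: cmod_power2) (simp add: power2_eq_square algebra_simps)
        also have "t\<^sup>2 * (cmod (F z))\<^sup>2 \<le> t\<^sup>2 * M\<^sup>2"
          using elim(1) by (intro mult_left_mono power_mono) auto
        also have "1 + (2 * t * Re (F z) + t\<^sup>2 * M\<^sup>2) \<le> exp (2 * t * Re (F z) + t)"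
          using exp_ge_add_one_self[of "2 * t * Re (F z) + t"] t(2) by simp
        also have "\<dots> = (exp (t * Re (F z) + t / 2))\<^sup>2"
          by (simp add: power2_eq_square exp_add[symmetric] algebra_simps)
        finally have "cmod (1 + of_real t * F z) \<le> exp (t * Re (F z) + t / 2)"
          by (rule power2_le_imp_le) simp_all
        then have "cmod ((1 + of_real t * F z) * \<kappa> z) \<le>
            exp (t * Re (F z) + t / 2) * (exp (- t * Re (F z)) * exp (- t))"
          unfolding norm_mult \<kappa>_def using elim by (intro mult_mono) auto
        also have "\<dots> = exp (- t / 2)"
          by (simp add: exp_add[symmetric])
        finally show ?case .
      qed
    qed
  qed
  also have "\<dots> < 1" using t(1) by simp
  finally obtain b where b: "b \<in> D" "b * (1 - Y) = 1"
    using neumann[OF YD] by blast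
  \<comment> \<open>The factor \<open>Z\<close> in \<open>b * (Z * d) = 1\<close> cancels against
    the conjugate, leaving a product of elements of \<open>D\<close>.\<close>
  have "abs_linfty inverse = abs_linfty inverse * (b * (Z * d))"
    using b(2) by (simp add: Yd)
  also have "\<dots> = (abs_linfty inverse * Z) * (b * d)"
    by (simp only: mult_ac)
  also have "\<dots> = b * d"
    using abs_linfty_zbar(1) by (simp add: Z_def)
  also have "\<dots> \<in> D" using b(1) d by (rule mult)
  finally show ?thesis .
qed

end

lemma cmod_prod_one: "(\<And>i. i \<in> A \<Longrightarrow> cmod (f i) = 1) \<Longrightarrow> cmod (prod f A) = 1"
  by (induction A rule: infinite_finite_induct) (auto simp: norm_mult)

section \<open>Continuous functions and multipliers of arbitrary sets\<close>

context douglas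
begin

text \<open>A Laurent polynomial is a polynomial times a power of \<open>inverse\<close>, so
  \<open>zbar_in\<close> puts it into \<open>D\<close>; Weierstrass approximation and closedness do
  the rest.\<close>

lemma continuous_in:
  fixes \<phi> :: "complex \<Rightarrow> real"
  assumes \<phi>: "continuous_on UNIV \<phi>"
  shows "abs_linfty (\<lambda>z. of_real (\<phi> z)) \<in> D" "ess_bounded (\<lambda>z. of_real (\<phi> z))"
proof -
  have cont: "continuous_on (sphere 0 1) (\<lambda>z. complex_of_real (\<phi> z))"
    using continuous_on_subset[OF \<phi>] by (intro continuous_intros) auto
  have "bounded ((\<lambda>z. complex_of_real (\<phi> z)) ` sphere 0 1)"
    using cont by (intro compact_imp_bounded compact_continuous_image) auto
  then obtain B where B: "\<And>z. cmod z = 1 \<Longrightarrow> cmod (complex_of_real (\<phi> z)) \<le> B"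
    unfolding bounded_iff by (metis image_eqI mem_sphere_0)
  show eb: "ess_bounded (\<lambda>z. of_real (\<phi> z))"
    by (rule ess_boundedI[OF borel_measurable_circleI[OF cont] AE_circleI[OF B]])
  show "abs_linfty (\<lambda>z. of_real (\<phi> z)) \<in> D"
  proof (rule approx)
    fix e :: real assume "e > 0"
    obtain g where g: "laurent_on_circle (\<lambda>z. of_real (g z))" "\<And>z. cmod z = 1 \<Longrightarrow> \<bar>\<phi> z - g z\<bar> < e"
      using laurent_approx[OF \<phi> \<open>e > 0\<close>] by blast
    obtain N q where q: "\<And>z. cmod z = 1 \<Longrightarrow> of_real (g z) = poly q z / z ^ N"
      using g(1) by (auto simp: laurent_on_circle_def)
    have zbN: "abs_linfty inverse ^ N = abs_linfty (\<lambda>z. inverse z ^ N) \<and> ess_bounded (\<lambda>z. inverse z ^ N)"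
      by (induction N) (auto simp: abs_linfty_one abs_linfty_mult abs_linfty_zbar ess_bounded_const ess_bounded_mult)
    have "abs_linfty (poly q) * abs_linfty inverse ^ N \<in> D"
      by (intro mult power zbar_in poly_limit poly_limit_poly)
    moreover have "norm (abs_linfty (\<lambda>z. of_real (\<phi> z)) - abs_linfty (poly q) * abs_linfty inverse ^ N) \<le> e"
      using zbN eb
    proof (simp add: abs_linfty_mult abs_linfty_diff ess_bounded_poly ess_bounded_mult, intro norm_abs_linfty_le)
      show "AE z in circle_measure. cmod (complex_of_real (\<phi> z) - poly q z * inverse z ^ N) \<le> e"
      proof (rule AE_circleI)
        fix z :: complex assume z: "cmod z = 1"
        have eq: "complex_of_real (\<phi> z) - poly q z * inverse z ^ N = of_real (\<phi> z - g z)"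
          by (simp add: q[OF z] divide_inverse power_inverse)
        show "cmod (complex_of_real (\<phi> z) - poly q z * inverse z ^ N) \<le> e"
          unfolding eq norm_of_real using g(2)[OF z] by simp
      qed
    qed (intro ess_bounded_mult ess_bounded_diff ess_bounded_poly, auto)
    ultimately show "\<exists>d\<in>D. norm (abs_linfty (\<lambda>z. of_real (\<phi> z)) - d) \<le> e" by blast
  qed
qed

lemma ess_bounded_indicator: "E \<in> sets circle_measure \<Longrightarrow> ess_bounded (indicator E)"
  by (rule ess_boundedI[of _ 1]) (auto simp: indicator_def)

text \<open>If \<open>\<phi>\<close> is continuous and equals \<open>indicator E\<close> off \<open>e\<close>, then
  \<open>indicator E = \<phi> - \<phi> * indicator e + indicator (E \<inter> e)\<close>; since \<open>\<phi> \<in> D\<close>, only the small sets \<open>e\<close>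
  and \<open>E \<inter> e\<close> need a multiplier.\<close>

lemma approximate_multiplier:
  assumes E: "E \<in> sets circle_measure" and "\<epsilon> > 0"
  shows "\<exists>c d. poly_limit c \<and> (AE z in circle_measure. cmod (c z) = 1) \<and>
    (LINT z|circle_measure. cmod (c z - 1)) \<le> \<epsilon> \<and>
    d \<in> D \<and> norm (abs_linfty (\<lambda>z. c z * indicator E z) - d) \<le> \<epsilon>"
proof -
  \<comment> \<open>Half of \<open>\<epsilon>\<close> for each of the two small sets, since the
    errors of \<open>c1\<close> and \<open>c2\<close> add up.\<close>
  obtain \<eta> :: real where \<eta>: "\<eta> > 0"
    "\<And>E. E \<in> sets circle_measure \<Longrightarrow> measure circle_measure E < \<eta> \<Longrightarrow>
      \<exists>c h. poly_limit c \<and> poly_limit h \<and> (AE z in circle_measure. cmod (c z) = 1) \<and>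
        (LINT z|circle_measure. cmod (c z - 1)) \<le> \<epsilon> / 2 \<and>
        (AE z in circle_measure. cmod (c z * indicator E z - h z) \<le> \<epsilon> / 2)"
    using small_set_multiplier[OF half_gt_zero[OF \<open>\<epsilon> > 0\<close>]] by blast
  obtain \<phi> :: "complex \<Rightarrow> real" and e where \<phi>: "continuous_on UNIV \<phi>" "\<And>z. 0 \<le> \<phi> z \<and> \<phi> z \<le> 1"
    and e: "e \<in> sets circle_measure" "measure circle_measure e < \<eta>"
    and eq: "\<And>z. z \<in> sphere 0 1 - e \<Longrightarrow> \<phi> z = indicator E z"
    by (rule indicator_eq_continuous_off_small_set[OF E \<eta>(1)]) blast
  have Ee: "E \<inter> e \<in> sets circle_measure" using E e by blast
  have "measure circle_measure (E \<inter> e) \<le> measure circle_measure e"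
    using e Ee by (intro circle.finite_measure_mono) auto
  then have "measure circle_measure (E \<inter> e) < \<eta>" using e(2) by linarith
  from \<eta>(2)[OF Ee this] obtain c2 h2 where 2: "poly_limit c2" "poly_limit h2"
      "AE z in circle_measure. cmod (c2 z) = 1" "(LINT z|circle_measure. cmod (c2 z - 1)) \<le> \<epsilon> / 2"
      "AE z in circle_measure. cmod (c2 z * indicator (E \<inter> e) z - h2 z) \<le> \<epsilon> / 2"
    by blast
  from \<eta>(2)[OF e] obtain c1 h1 where 1: "poly_limit c1" "poly_limit h1"
      "AE z in circle_measure. cmod (c1 z) = 1" "(LINT z|circle_measure. cmod (c1 z - 1)) \<le> \<epsilon> / 2"
      "AE z in circle_measure. cmod (c1 z * indicator e z - h1 z) \<le> \<epsilon> / 2"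
    by blast
  define c where "c z = c1 z * c2 z" for z
  have c: "poly_limit c" unfolding c_def using 1(1) 2(1) by (rule poly_limit_mult)
  note eb = poly_limit_ess_bounded[OF 1(1)] poly_limit_ess_bounded[OF 1(2)]
    poly_limit_ess_bounded[OF 2(1)] poly_limit_ess_bounded[OF 2(2)] poly_limit_ess_bounded[OF c]
    continuous_in(2)[OF \<phi>(1)] ess_bounded_indicator[OF E]
  note eb' = ess_bounded_mult ess_bounded_diff ess_bounded_add ess_bounded_const eb
  have unimod: "AE z in circle_measure. cmod (c z) = 1"
    using 1(3) 2(3) by eventually_elim (simp add: c_def norm_mult)
  have "(LINT z|circle_measure. cmod (c z - 1)) \<le>
      (LINT z|circle_measure. cmod (c1 z - 1) + cmod (c2 z - 1))"
  proof (rule integral_mono_AE)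
    show "AE z in circle_measure. cmod (c z - 1) \<le> cmod (c1 z - 1) + cmod (c2 z - 1)"
      using 1(3)
    proof eventually_elim
      case (elim z)
      have eq: "c z - 1 = c1 z * (c2 z - 1) + (c1 z - 1)" by (simp add: c_def algebra_simps)
      have "cmod (c z - 1) \<le> cmod (c1 z * (c2 z - 1)) + cmod (c1 z - 1)"
        unfolding eq by (rule norm_triangle_ineq)
      then show ?case by (simp add: norm_mult elim)
    qed
  qed (intro integrable_norm Bochner_Integration.integrable_add integrable_ess_bounded eb')+
  also have "\<dots> = (LINT z|circle_measure. cmod (c1 z - 1)) + (LINT z|circle_measure. cmod (c2 z - 1))"
    by (intro Bochner_Integration.integral_add integrable_norm integrable_ess_bounded eb')
  also have "\<dots> \<le> \<epsilon>" using 1(4) 2(4) by simp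
  finally have L1: "(LINT z|circle_measure. cmod (c z - 1)) \<le> \<epsilon>" .
  \<comment> \<open>This is \<open>c * indicator E\<close>, expanded by the decomposition above,
    with \<open>c1 * indicator e\<close> and \<open>c2 * indicator (E \<inter> e)\<close> replaced
    by their analytic approximants \<open>h1\<close> and \<open>h2\<close>.\<close>
  define g where "g z = (c z * of_real (\<phi> z) - of_real (\<phi> z) * (c2 z * h1 z)) + c1 z * h2 z" for z
  have "abs_linfty g = (abs_linfty c * abs_linfty (\<lambda>z. of_real (\<phi> z)) -
      abs_linfty (\<lambda>z. of_real (\<phi> z)) * (abs_linfty c2 * abs_linfty h1)) + abs_linfty c1 * abs_linfty h2"
    unfolding g_def by (simp add: abs_linfty_mult abs_linfty_diff abs_linfty_add eb')
  also have "\<dots> \<in> D"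
    by (intro add diff mult continuous_in \<phi> poly_limit c 1 2)
  finally have "abs_linfty g \<in> D" .
  moreover have "norm (abs_linfty (\<lambda>z. c z * indicator E z) - abs_linfty g) \<le> \<epsilon>"
  proof -
    have g: "ess_bounded g" unfolding g_def by (intro eb')
    have cE: "ess_bounded (\<lambda>z. c z * indicator E z)" by (intro eb')
    show ?thesis
      unfolding abs_linfty_diff[OF cE g]
    proof (rule norm_abs_linfty_le)
      show "ess_bounded (\<lambda>z. c z * indicator E z - g z)" by (intro ess_bounded_diff cE g)
      show "AE z in circle_measure. cmod (c z * indicator E z - g z) \<le> \<epsilon>"
        using 1(3,5) 2(3,5) circle_AE
      proof eventually_elim
        case (elim z)
        have "c z * indicator E z - g z =
            c1 z * (c2 z * indicator (E \<inter> e) z - h2 z) - of_real (\<phi> z) * c2 z * (c1 z * indicator e z - h1 z)"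
        proof (cases "z \<in> e")
          case True
          then show ?thesis by (simp add: g_def c_def indicator_def algebra_simps)
        next
          case False
          then have "\<phi> z = indicator E z" using eq[of z] elim(5) by simp
          with False show ?thesis by (simp add: g_def c_def indicator_def algebra_simps)
        qed
        also have "cmod \<dots> \<le> cmod (c1 z * (c2 z * indicator (E \<inter> e) z - h2 z)) +
            cmod (of_real (\<phi> z) * c2 z * (c1 z * indicator e z - h1 z))"
          by (rule norm_triangle_ineq4)
        also have "\<dots> = 1 * cmod (c2 z * indicator (E \<inter> e) z - h2 z) + \<bar>\<phi> z\<bar> * cmod (c1 z * indicator e z - h1 z)"
          by (simp add: norm_mult elim(1,3))
        also have "\<dots> \<le> 1 * (\<epsilon> / 2) + 1 * (\<epsilon> / 2)"
          using elim(2,4) \<phi>(2)[of z] by (intro add_mono mult_mono) auto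
        finally show ?case by simp
      qed
    qed
  qed
  ultimately show ?thesis using c unimod L1 by blast
qed

text \<open>Let \<open>b\<close> be the product of approximate multipliers \<open>c n\<close>.
  Omitting the factor \<open>c n\<close> leaves an element \<open>r\<close> of \<open>hinfty\<close>
  of norm at most 1, so \<open>b * indicator E = r * (c n * indicator E)\<close> is within
  \<open>(1/2) ^ n\<close> of \<open>r * d n\<close>, for every \<open>n\<close>.\<close>

lemma indicator_multiplier:
  assumes E: "E \<in> sets circle_measure"
  obtains b where "ess_bounded b" "AE z in circle_measure. cmod (b z) = 1" "abs_linfty b \<in> D"
    "abs_linfty (\<lambda>z. b z * indicator E z) \<in> D"
proof -
  \<comment> \<open>The rate \<open>(1/2) ^ n\<close> serves twice: summability makes the infinite
    product converge, and the uniform error tends to 0.\<close>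
  define Q where "Q n c d \<longleftrightarrow> poly_limit c \<and> (AE z in circle_measure. cmod (c z) = 1) \<and>
    (LINT z|circle_measure. cmod (c z - 1)) \<le> (1/2) ^ n \<and>
    d \<in> D \<and> norm (abs_linfty (\<lambda>z. c z * indicator E z) - d) \<le> (1/2) ^ n" for n :: nat and c d
  have "\<exists>c d. Q n c d" for n
    unfolding Q_def by (rule approximate_multiplier[OF E]) simp
  then obtain c d where "\<And>n. Q n (c n) (d n)" by metis
  then have c: "\<And>n. poly_limit (c n)" "\<And>n. AE z in circle_measure. cmod (c n z) = 1"
      "\<And>n. (LINT z|circle_measure. cmod (c n z - 1)) \<le> (1/2) ^ n"
    and d: "\<And>n. d n \<in> D" "\<And>n. norm (abs_linfty (\<lambda>z. c n z * indicator E z) - d n) \<le> (1/2) ^ n"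
    unfolding Q_def by blast+
  note [measurable] = poly_limit_measurable[OF c(1)]
  have all1: "AE z in circle_measure. \<forall>n. cmod (c n z) = 1"
    using c(2) by (simp add: AE_all_countable)
  have sm: "AE z in circle_measure. summable (\<lambda>n. norm (c n z - 1))"
  proof (rule AE_summable_norm)
    show "integrable circle_measure (\<lambda>z. c n z - 1)" for n
      by (intro integrable_ess_bounded ess_bounded_diff poly_limit_ess_bounded c ess_bounded_const)
    show "(LINT z|circle_measure. norm (c n z - 1)) \<le> (1/2) ^ n" for n
      by (rule c(3))
  qed auto
  define P where "P N z = (\<Prod>n<N. c n z)" for N z
  have conv: "AE z in circle_measure. convergent (\<lambda>N. P N z)"
    using sm all1
  proof eventually_elim
    case (elim z)
    have P1: "cmod (P N z) = 1" for N
      unfolding P_def using elim(2) by (intro cmod_prod_one) blast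
    \<comment> \<open>Partial products are unimodular, so convergence of the product reduces to
      summability of \<open>c n - 1\<close>.\<close>
    have "norm (P (Suc n) z - P n z) = norm (c n z - 1)" for n
    proof -
      have "P (Suc n) z - P n z = P n z * (c n z - 1)" by (simp add: P_def algebra_simps)
      then show ?thesis by (simp add: norm_mult P1)
    qed
    then have "summable (\<lambda>n. P (Suc n) z - P n z)"
      using elim(1) by (simp add: summable_norm_cancel)
    then show ?case
      unfolding summable_iff_convergent sum_lessThan_telescope[of "\<lambda>n. P n z"]
        convergent_diff_const_right_iff .
  qed
  have [measurable]: "P N \<in> borel_measurable circle_measure" for N
    unfolding P_def by measurable
  define b where "b z = lim (\<lambda>N. P N z)" for z
  have bm [measurable]: "b \<in> borel_measurable circle_measure"
    unfolding b_def by measurable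
  have lim: "AE z in circle_measure. (\<lambda>N. P N z) \<longlonglongrightarrow> b z"
    using conv by eventually_elim (simp add: b_def convergent_LIMSEQ_iff)
  have b1: "AE z in circle_measure. cmod (b z) = 1"
    using lim all1
  proof eventually_elim
    case (elim z)
    have "cmod (P N z) = 1" for N
      unfolding P_def using elim(2) by (intro cmod_prod_one) blast
    with tendsto_norm[OF elim(1)] show ?case by (simp add: LIMSEQ_const_iff)
  qed
  have b: "ess_bounded b" using bm b1 by (intro ess_boundedI[of _ 1]) (auto elim: eventually_mono)
  have "P N = (\<lambda>z. \<Prod>n<N. c n z)" for N by (simp add: P_def fun_eq_iff)
  then have PP: "poly_limit (P N)" for N
    using poly_limit_prod[of "{..<N}" c] c(1) by simp
  have "abs_linfty b \<in> hinfty"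
  proof (rule hinfty_limit[OF bm PP _ lim])
    show "AE z in circle_measure. cmod (P N z) \<le> 1" for N
      using all1 by eventually_elim (simp add: P_def cmod_prod_one)
  qed
  then have bD: "abs_linfty b \<in> D" by (rule hinfty)
  have bE: "ess_bounded (\<lambda>z. b z * indicator E z)"
    by (intro ess_bounded_mult b ess_bounded_indicator E)
  have "abs_linfty (\<lambda>z. b z * indicator E z) \<in> D"
  proof (rule approx)
    fix e :: real assume "e > 0"
    then obtain n where n: "(1/2) ^ n < e"
      using real_arch_pow_inv[of e "1/2"] by auto
    \<comment> \<open>Conjugation is inversion for unimodular values: \<open>r\<close> is the
      product with its \<open>n\<close>-th factor removed, hence still a limit of analytic
      products.\<close>
    define r where "r z = b z * cnj (c n z)" for z
    have "(\<lambda>z. cnj (c n z)) \<in> borel_measurable circle_measure"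
      by (rule measurable_compose[OF poly_limit_measurable[OF c(1)]])
        (intro borel_measurable_continuous_onI continuous_intros)
    note [measurable] = this
    have rm [measurable]: "r \<in> borel_measurable circle_measure"
      unfolding r_def by measurable
    have r1: "AE z in circle_measure. cmod (r z) = 1"
      using b1 all1 by eventually_elim (simp add: r_def norm_mult)
    then have r: "ess_bounded r"
      using rm by (intro ess_boundedI[of _ 1]) (auto elim: eventually_mono)
    have "abs_linfty r \<in> hinfty"
    proof (rule hinfty_limit[OF rm])
      show "poly_limit (\<lambda>z. \<Prod>k\<in>{..<N} - {n}. c k z)" for N
        by (intro poly_limit_prod c) simp
      show "AE z in circle_measure. cmod (\<Prod>k\<in>{..<N} - {n}. c k z) \<le> 1" for N
        using all1 by eventually_elim (simp add: cmod_prod_one)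
      show "AE z in circle_measure. (\<lambda>N. \<Prod>k\<in>{..<N} - {n}. c k z) \<longlonglongrightarrow> r z"
        using lim all1
      proof eventually_elim
        case (elim z)
        have cc: "c n z * cnj (c n z) = 1"
          using elim(2) complex_norm_square[of "c n z"] by simp
        have "(\<Prod>k\<in>{..<N} - {n}. c k z) = P N z * cnj (c n z)" if "N > n" for N
        proof -
          have "P N z = c n z * (\<Prod>k\<in>{..<N} - {n}. c k z)"
            unfolding P_def using that by (intro prod.remove) auto
          then show ?thesis using cc by (simp add: algebra_simps)
        qed
        then have "\<forall>\<^sub>F N in sequentially. P N z * cnj (c n z) = (\<Prod>k\<in>{..<N} - {n}. c k z)"
          by (intro eventually_mono[OF eventually_gt_at_top[of n]]) simp
        moreover have "(\<lambda>N. P N z * cnj (c n z)) \<longlonglongrightarrow> r z"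
          unfolding r_def by (intro tendsto_intros elim)
        ultimately show ?case by (rule Lim_transform_eventually[rotated])
      qed
    qed
    then have rD: "abs_linfty r \<in> D" by (rule hinfty)
    have cE: "ess_bounded (\<lambda>z. c n z * indicator E z)"
      by (intro ess_bounded_mult poly_limit_ess_bounded c ess_bounded_indicator E)
    have "abs_linfty (\<lambda>z. b z * indicator E z) = abs_linfty r * abs_linfty (\<lambda>z. c n z * indicator E z)"
      unfolding abs_linfty_mult[OF r cE]
    proof (rule abs_linfty_eqI[OF bE ess_bounded_mult[OF r cE]])
      show "AE z in circle_measure. b z * indicator E z = r z * (c n z * indicator E z)"
        using all1
      proof eventually_elim
        case (elim z)
        have "cnj (c n z) * c n z = 1"
          using elim complex_norm_square[of "c n z"] by (simp add: mult.commute)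
        then have "b z * (cnj (c n z) * c n z) * indicator E z = b z * indicator E z" by simp
        then show ?case by (simp only: r_def mult.assoc)
      qed
    qed
    then have "norm (abs_linfty (\<lambda>z. b z * indicator E z) - abs_linfty r * d n) =
        norm (abs_linfty r * (abs_linfty (\<lambda>z. c n z * indicator E z) - d n))"
      by (simp add: right_diff_distrib)
    also have "\<dots> \<le> norm (abs_linfty r) * norm (abs_linfty (\<lambda>z. c n z * indicator E z) - d n)"
      by (rule norm_mult_ineq)
    also have "\<dots> \<le> 1 * (1/2) ^ n"
      using r r1 d(2) by (intro mult_mono norm_abs_linfty_le) (auto elim: eventually_mono)
    finally have "norm (abs_linfty (\<lambda>z. b z * indicator E z) - abs_linfty r * d n) \<le> e"
      using n by simp
    then show "\<exists>g\<in>D. norm (abs_linfty (\<lambda>z. b z * indicator E z) - g) \<le> e"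
      using mult[OF rD d(1)[of n]] by blast
  qed
  then show ?thesis using that b b1 bD by blast
qed

end

section \<open>Characters\<close>

text \<open>By Zorn there is a minimal proper filter below \<open>F\<close>; a predicate it left
  undecided could be adjoined to give a smaller proper one. The infimum of a chain stays proper
  because a chain is a filter base.\<close>

lemma ultrafilter_exists:
  fixes F :: "'a filter"
  assumes "F \<noteq> bot"
  obtains U where "U \<le> F" "U \<noteq> bot" "\<And>P. eventually P U \<or> eventually (\<lambda>x. \<not> P x) U"
proof -
  define A where "A = {G. G \<le> F \<and> G \<noteq> bot}"
  have "\<exists>m\<in>A. \<forall>a\<in>A. a \<le> m \<longrightarrow> a = m"
  proof (rule predicate_Zorn)
    show "partial_order_on A (relation_of (\<lambda>a b. b \<le> a) A)"
      by (rule partial_order_on_relation_ofI) auto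
    fix C assume C: "C \<in> Chains (relation_of (\<lambda>a b. b \<le> a) A)"
    then have CA: "C \<subseteq> A" and chain: "\<And>G H. G \<in> C \<Longrightarrow> H \<in> C \<Longrightarrow> G \<le> H \<or> H \<le> G"
      by (auto simp: Chains_def relation_of_def)
    show "\<exists>u\<in>A. \<forall>a\<in>C. u \<le> a"
    proof (cases "C = {}")
      case True
      with assms show ?thesis by (auto simp: A_def)
    next
      case False
      have "\<not> eventually (\<lambda>_. False) (Inf C)"
      proof (subst eventually_Inf_base[OF False])
        show "\<exists>x\<in>C. x \<le> inf G H" if "G \<in> C" "H \<in> C" for G H
          using chain[OF that] that by auto
        show "\<not> (\<exists>b\<in>C. eventually (\<lambda>_. False) b)"
          using CA by (auto simp: A_def trivial_limit_def)
      qed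
      then have "Inf C \<noteq> bot" by (simp add: trivial_limit_def)
      moreover have "Inf C \<le> F"
        using False CA by (auto simp: A_def intro: Inf_lower2)
      ultimately show ?thesis by (intro bexI[of _ "Inf C"]) (auto simp: A_def intro: Inf_lower)
    qed
  qed
  then obtain U where U: "U \<le> F" "U \<noteq> bot" and min: "\<And>G. G \<le> F \<Longrightarrow> G \<noteq> bot \<Longrightarrow> G \<le> U \<Longrightarrow> G = U"
    by (auto simp: A_def)
  have "eventually P U \<or> eventually (\<lambda>x. \<not> P x) U" for P
  proof (rule disjCI)
    assume "\<not> eventually (\<lambda>x. \<not> P x) U"
    then have "inf U (principal {x. P x}) \<noteq> bot"
      by (simp add: trivial_limit_def eventually_inf_principal)
    then have "inf U (principal {x. P x}) = U"
      using U(1) by (intro min) (auto intro: le_infI1)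
    moreover have "eventually P (inf U (principal {x. P x}))"
      by (simp add: eventually_inf_principal)
    ultimately show "eventually P U" by simp
  qed
  with U show ?thesis by (rule that)
qed

text \<open>Compactness of the ball gives a cluster point, and an ultrafilter converges to each of
  its cluster points.\<close>

lemma ultrafilter_bounded_convergent:
  fixes g :: "'a \<Rightarrow> complex"
  assumes U: "U \<noteq> bot" "\<And>P. eventually P U \<or> eventually (\<lambda>x. \<not> P x) U"
    and bounded: "eventually (\<lambda>x. cmod (g x) \<le> B) U"
  obtains l where "(g \<longlongrightarrow> l) U"
proof -
  have "eventually (\<lambda>y. y \<in> cball 0 B) (filtermap g U)"
    using bounded by (simp add: eventually_filtermap)
  moreover have "filtermap g U \<noteq> bot" using U(1) by (simp add: filtermap_bot_iff)
  ultimately obtain l where l: "inf (nhds l) (filtermap g U) \<noteq> bot"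
    using compact_cball[of "0::complex" B] unfolding compact_filter by blast
  have "(g \<longlongrightarrow> l) U"
  proof (rule topological_tendstoI, rule ccontr)
    fix T assume T: "open T" "l \<in> T" "\<not> eventually (\<lambda>x. g x \<in> T) U"
    then have "eventually (\<lambda>x. g x \<notin> T) U" using U(2)[of "\<lambda>x. g x \<in> T"] by blast
    then have "eventually (\<lambda>y. y \<notin> T) (filtermap g U)" by (simp add: eventually_filtermap)
    moreover have "eventually (\<lambda>y. y \<in> T) (nhds l)"
      using T(1,2) by (rule eventually_nhds_in_open)
    ultimately have "eventually (\<lambda>_. False) (inf (nhds l) (filtermap g U))"
      unfolding eventually_inf by blast
    with l show False by (simp add: trivial_limit_def)
  qed
  then show ?thesis by (rule that)
qed

text \<open>If \<open>x\<close> were outside \<open>T\<close>, a function with value 1 at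
  \<open>x\<close> and support off \<open>T\<close> would vanish on \<open>T\<close>, where its
  modulus must be maximal. This gives both the minimality of the Shilov boundary and the maximality
  of the set of regularity points.\<close>

lemma regularity_point_in_closed_boundary:
  assumes T: "closed_boundary A T" and x: "regularity_point_type_one A x"
  shows "x \<in> T"
proof (rule ccontr)
  assume "x \<notin> T"
  let ?X = "gelfand_topology A"
  have T': "closedin ?X T" "\<And>f. f \<in> A \<Longrightarrow> \<exists>t\<in>T. \<forall>y\<in>characters A. cmod (y f) \<le> cmod (t f)"
    using T by (auto simp: closed_boundary_def)
  have sub: "T \<subseteq> characters A" using closedin_subset[OF T'(1)] by simp
  have "openin ?X (characters A - T)"
    using T'(1) by (simp add: closedin_def)
  then obtain f where f: "f \<in> A" "x f = 1" "gelfand_support A f \<subseteq> characters A - T"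
    using x \<open>x \<notin> T\<close> unfolding regularity_point_type_one_def by (metis Diff_iff Diff_subset order_refl)
  obtain t where t: "t \<in> T" "cmod (x f) \<le> cmod (t f)"
    using T'(2)[OF f(1)] x unfolding regularity_point_type_one_def by blast
  then have "t f \<noteq> 0" using f(2) by auto
  then have "t \<in> {y \<in> characters A. y f \<noteq> 0}" using t sub by auto
  also have "\<dots> \<subseteq> gelfand_support A f"
    unfolding gelfand_support_def by (rule closure_of_subset) auto
  finally show False using f(3) t(1) by auto
qed

lemma continuous_map_gelfand_eval:
  "f \<in> A \<Longrightarrow> continuous_map (gelfand_topology A) euclidean (\<lambda>x. x f)"
  unfolding gelfand_topology_def
  by (rule continuous_map_from_subtopology) (rule continuous_map_product_projection)

lemma closedin_gelfand_level:
  assumes "f \<in> A" "closed C"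
  shows "closedin (gelfand_topology A) {x \<in> characters A. x f \<in> C}"
  using closedin_continuous_map_preimage[OF continuous_map_gelfand_eval[OF assms(1)], of C] assms(2)
  by simp

text \<open>One representative suffices, as all agree almost everywhere. The conjugate of
  \<open>b\<close> need not lie in \<open>D\<close>, so a character of \<open>D\<close> may send
  \<open>b\<close> to a number of modulus below 1.\<close>

definition unimodular :: "linfty \<Rightarrow> bool" where
  "unimodular b \<longleftrightarrow> (\<exists>f. ess_bounded f \<and> b = abs_linfty f \<and> (AE z in circle_measure. cmod (f z) = 1))"

section \<open>Characters of a Douglas algebra and a closed boundary\<close>

context douglas
begin

lemma character_add: "x \<in> characters D \<Longrightarrow> f \<in> D \<Longrightarrow> g \<in> D \<Longrightarrow> x (f + g) = x f + x g"
  and character_mult: "x \<in> characters D \<Longrightarrow> f \<in> D \<Longrightarrow> g \<in> D \<Longrightarrow> x (f * g) = x f * x g"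
  and character_scaleC: "x \<in> characters D \<Longrightarrow> f \<in> D \<Longrightarrow> x (c *\<^sub>C f) = c * x f"
  by (auto simp: characters_def)

lemma character_one: "x \<in> characters D \<Longrightarrow> x 1 = 1"
proof -
  assume x: "x \<in> characters D"
  then obtain f where "f \<in> D" "x f \<noteq> 0" by (auto simp: characters_def)
  then show "x 1 = 1" using character_mult[OF x, of f 1] one by simp
qed

lemma character_diff:
  assumes "x \<in> characters D" "f \<in> D" "g \<in> D"
  shows "x (f - g) = x f - x g"
  using character_add[OF assms(1) diff[OF assms(2,3)] assms(3)] by simp

lemma character_zero: "x \<in> characters D \<Longrightarrow> x 0 = 0"
  using character_diff[of x 1 1] one by simp

lemma character_power: "x \<in> characters D \<Longrightarrow> f \<in> D \<Longrightarrow> x (f ^ n) = x f ^ n"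
  by (induction n) (auto simp: character_one character_mult power)

lemma character_prod:
  "x \<in> characters D \<Longrightarrow> (\<And>i. i \<in> A \<Longrightarrow> f i \<in> D) \<Longrightarrow> x (prod f A) = (\<Prod>i\<in>A. x (f i))"
  by (induction A rule: infinite_finite_induct) (auto simp: character_one character_mult prod)

text \<open>Otherwise \<open>1 - f / x f\<close> would be invertible in \<open>D\<close> by the
  Neumann series, although \<open>x\<close> sends it to 0.\<close>

lemma character_norm_le:
  assumes x: "x \<in> characters D" and f: "f \<in> D"
  shows "cmod (x f) \<le> norm f"
proof (rule ccontr)
  assume "\<not> cmod (x f) \<le> norm f"
  then have *: "norm f < cmod (x f)" by simp
  then have nz: "x f \<noteq> 0" by auto
  define a where "a = (1 / x f) *\<^sub>C f"
  have a: "a \<in> D" unfolding a_def using f by (rule scaleC)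
  have "norm a < 1" using * nz by (simp add: a_def norm_scaleC norm_divide field_simps)
  then obtain b where b: "b \<in> D" "b * (1 - a) = 1" using neumann[OF a] by blast
  have "x (1 - a) = 0"
    using x f a one nz by (simp add: character_diff character_one) (simp add: a_def character_scaleC)
  then have "x (b * (1 - a)) = 0"
    using x b(1) a one by (simp add: character_mult diff)
  with b(2) character_one[OF x] show False by simp
qed

text \<open>Stands in for the restrictions of characters of \<open>L^\<infinity>\<close>. The
  condition is closed, refers to \<open>D\<close> only, and keeps \<open>x b\<close> away from 0 for
  every multiplier \<open>b\<close>.\<close>

definition unimodular_characters :: "(linfty \<Rightarrow> complex) set" where
  "unimodular_characters = {x \<in> characters D. \<forall>b\<in>D. unimodular b \<longrightarrow> cmod (x b) = 1}"

lemma closedin_unimodular_characters: "closedin (gelfand_topology D) unimodular_characters"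
proof -
  \<comment> \<open>Keeps the index set of the following intersection nonempty.\<close>
  have "unimodular 1"
    unfolding unimodular_def by (intro exI[of _ "\<lambda>_. 1"]) (simp add: abs_linfty_one ess_bounded_const)
  then have "unimodular_characters = (\<Inter>b\<in>{b\<in>D. unimodular b}. {x \<in> characters D. x b \<in> sphere 0 1})"
    using one by (auto simp: unimodular_characters_def)
  also have "closedin (gelfand_topology D) \<dots>"
    using \<open>unimodular 1\<close> one by (intro closedin_INT closedin_gelfand_level) auto
  finally show ?thesis .
qed

text \<open>Evaluating representatives along an ultrafilter of sets that are not null gives a character of
  \<open>L\<^sup>\<infinity>\<close>; the ultrafilter is chosen to contain all sets \<open>cmod f > norm f - \<epsilon>\<close>.\<close>

lemma unimodular_characters_attains_norm:
  assumes f: "f \<in> D"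
  obtains x where "x \<in> unimodular_characters" "norm f \<le> cmod (x f)"
proof -
  obtain f0 where f0: "ess_bounded f0" "f = abs_linfty f0" by (rule abs_linfty_cases)
  \<comment> \<open>The part from \<open>ae_filter\<close> makes null sets negligible; the principal
    parts concentrate the filter where \<open>cmod (f0 z)\<close> is close to \<open>norm f\<close>.
    It is proper because none of those sets is null.\<close>
  define F where "F = (INF \<epsilon>\<in>{0<..}. inf (ae_filter circle_measure) (principal {z. norm f - \<epsilon> < cmod (f0 z)}))"
  have F: "eventually P F \<longleftrightarrow> (\<exists>\<epsilon>>0. AE z in circle_measure. norm f - \<epsilon> < cmod (f0 z) \<longrightarrow> P z)" for P
    unfolding F_def
  proof (subst eventually_INF_base)
    fix a b :: real assume "a \<in> {0<..}" "b \<in> {0<..}"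
    then show "\<exists>x\<in>{0<..}. inf (ae_filter circle_measure) (principal {z. norm f - x < cmod (f0 z)}) \<le>
        inf (inf (ae_filter circle_measure) (principal {z. norm f - a < cmod (f0 z)}))
          (inf (ae_filter circle_measure) (principal {z. norm f - b < cmod (f0 z)}))"
      by (intro bexI[of _ "min a b"]) (auto intro!: le_infI2)
  qed (auto simp: eventually_inf_principal)
  have "F \<noteq> bot"
  proof
    assume "F = bot"
    then have "eventually (\<lambda>_. False) F" by simp
    then obtain \<epsilon> where "\<epsilon> > 0" "AE z in circle_measure. norm f - \<epsilon> < cmod (f0 z) \<longrightarrow> False"
      unfolding F by blast
    then have "AE z in circle_measure. cmod (f0 z) \<le> norm f - \<epsilon>"
      by (auto elim: eventually_mono)
    then have "norm f \<le> norm f - \<epsilon>"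
      using norm_abs_linfty_le[OF f0(1)] f0(2) by simp
    with \<open>\<epsilon> > 0\<close> show False by simp
  qed
  then obtain U where U: "U \<le> F" "U \<noteq> bot" "\<And>P. eventually P U \<or> eventually (\<lambda>x. \<not> P x) U"
    by (rule ultrafilter_exists) blast
  have AE_U: "eventually P U" if "AE z in circle_measure. P z" for P
  proof -
    have "eventually P F"
      unfolding F using that by (intro exI[of _ 1]) (auto elim: eventually_mono)
    then show ?thesis using U(1) by (rule filter_leD[rotated])
  qed
  have conv: "\<exists>l. (g \<longlongrightarrow> l) U" if "ess_bounded g" for g
  proof -
    have "eventually (\<lambda>z. cmod (g z) \<le> ess_norm g) U"
      using ess_norm_AE[OF that] by (rule AE_U)
    then show ?thesis using ultrafilter_bounded_convergent[OF U(2,3)] by blast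
  qed
  \<comment> \<open>Any choice of representatives serves: by \<open>AE_U\<close>, two of them agree
    along \<open>U\<close> and have the same limit.\<close>
  define r where "r h = (SOME g. ess_bounded g \<and> h = abs_linfty g)" for h
  have r: "ess_bounded (r h)" "abs_linfty (r h) = h" for h
    using someI_ex[of "\<lambda>g. ess_bounded g \<and> h = abs_linfty g"] abs_linfty_cases[of h]
    unfolding r_def by metis+
  define X where "X h = Lim U (r h)" for h
  have X: "(g \<longlongrightarrow> X (abs_linfty g)) U" if g: "ess_bounded g" for g
  proof -
    obtain l where l: "(g \<longlongrightarrow> l) U" using conv[OF g] by blast
    have "linfty_rel (r (abs_linfty g)) g"
      using Quotient3_rel[OF Quotient3_linfty, of "r (abs_linfty g)" g] r g by (auto simp: linfty_rel_refl)
    then have "AE z in circle_measure. g z = r (abs_linfty g) z"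
      by (auto simp: linfty_rel_def elim: eventually_mono)
    then have "(r (abs_linfty g) \<longlongrightarrow> l) U"
      using l AE_U by (subst tendsto_cong[symmetric]) auto
    then have "X (abs_linfty g) = l" unfolding X_def using U(2) by (intro tendsto_Lim) auto
    with l show ?thesis by simp
  qed
  have Xeq: "X (abs_linfty g) = l" if "ess_bounded g" "(g \<longlongrightarrow> l) U" for g l
    using tendsto_unique[OF U(2) X[OF that(1)] that(2)] .
  have X_add: "X (g + h) = X g + X h" for g h
  proof -
    have "X (abs_linfty (\<lambda>z. r g z + r h z)) = X g + X h"
      using X[OF r(1)[of g]] X[OF r(1)[of h]]
      by (intro Xeq ess_bounded_add r tendsto_add) (simp_all add: r)
    then show ?thesis using abs_linfty_add[OF r(1)[of g] r(1)[of h]] by (simp add: r)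
  qed
  have X_mult: "X (g * h) = X g * X h" for g h
  proof -
    have "X (abs_linfty (\<lambda>z. r g z * r h z)) = X g * X h"
      using X[OF r(1)[of g]] X[OF r(1)[of h]]
      by (intro Xeq ess_bounded_mult r tendsto_mult) (simp_all add: r)
    then show ?thesis using abs_linfty_mult[OF r(1)[of g] r(1)[of h]] by (simp add: r)
  qed
  have X_scaleC: "X (c *\<^sub>C g) = c * X g" for c g
  proof -
    have "X (abs_linfty (\<lambda>z. c * r g z)) = c * X g"
      using X[OF r(1)[of g]]
      by (intro Xeq ess_bounded_mult ess_bounded_const r tendsto_mult tendsto_const) (simp_all add: r)
    then show ?thesis using abs_linfty_scaleC[OF r(1)[of g]] by (simp add: r)
  qed
  have X_one: "X 1 = 1"
    unfolding abs_linfty_one by (intro Xeq ess_bounded_const tendsto_const)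
  \<comment> \<open>Characters are extensional functions on \<open>D\<close>, so the functional on
    \<open>L^\<infinity>\<close> has to be restricted.\<close>
  define x where "x = restrict X D"
  have xX: "x g = X g" if "g \<in> D" for g using that by (simp add: x_def)
  have "x \<in> characters D"
    unfolding characters_def
  proof (safe)
    show "x \<in> extensional D" by (simp add: x_def)
    show "\<exists>f\<in>D. x f \<noteq> 0" using one X_one by (intro bexI[of _ 1]) (simp_all add: xX)
  qed (simp_all add: xX add mult scaleC X_add X_mult X_scaleC)
  moreover have "cmod (x b) = 1" if b: "b \<in> D" "unimodular b" for b
  proof -
    obtain g where g: "ess_bounded g" "b = abs_linfty g" "AE z in circle_measure. cmod (g z) = 1"
      using b(2) by (auto simp: unimodular_def)
    have "((\<lambda>z. cmod (g z)) \<longlongrightarrow> cmod (X b)) U"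
      unfolding g(2) by (intro tendsto_norm X g)
    moreover have "((\<lambda>z. cmod (g z)) \<longlongrightarrow> 1) U"
      by (rule tendsto_eventually) (rule AE_U[OF g(3)])
    ultimately show ?thesis using U(2) b(1) by (simp add: xX tendsto_unique)
  qed
  ultimately have "x \<in> unimodular_characters" by (simp add: unimodular_characters_def)
  moreover have "norm f \<le> cmod (x f)"
  proof (rule field_le_epsilon)
    fix \<epsilon> :: real assume "\<epsilon> > 0"
    then have "eventually (\<lambda>z. norm f - \<epsilon> < cmod (f0 z)) F" unfolding F by auto
    then have "eventually (\<lambda>z. norm f - \<epsilon> < cmod (f0 z)) U"
      by (rule filter_leD[OF U(1)])
    then have "eventually (\<lambda>z. norm f - \<epsilon> \<le> cmod (f0 z)) U"
      by (rule eventually_mono) simp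
    moreover have "((\<lambda>z. cmod (f0 z)) \<longlongrightarrow> cmod (X f)) U"
      unfolding f0(2) by (intro tendsto_norm X f0)
    ultimately have "norm f - \<epsilon> \<le> cmod (X f)"
      using U(2) by (intro tendsto_lowerbound)
    then show "norm f \<le> cmod (x f) + \<epsilon>" using xX[OF f] by simp
  qed
  ultimately show ?thesis by (rule that)
qed

lemma closed_boundary_unimodular_characters: "closed_boundary D unimodular_characters"
  unfolding closed_boundary_def
proof (intro conjI ballI)
  fix f assume f: "f \<in> D"
  obtain x where x: "x \<in> unimodular_characters" "norm f \<le> cmod (x f)"
    using unimodular_characters_attains_norm[OF f] by blast
  then show "\<exists>x\<in>unimodular_characters. \<forall>y\<in>characters D. cmod (y f) \<le> cmod (x f)"
    using character_norm_le[OF _ f] order_trans by blast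
qed (rule closedin_unimodular_characters)

end

lemma abs_linfty_power:
  assumes "ess_bounded f"
  shows "abs_linfty f ^ n = abs_linfty (\<lambda>z. f z ^ n)" "ess_bounded (\<lambda>z. f z ^ n)"
proof -
  have "abs_linfty f ^ n = abs_linfty (\<lambda>z. f z ^ n) \<and> ess_bounded (\<lambda>z. f z ^ n)"
    using assms
    by (induction n) (auto simp: abs_linfty_one abs_linfty_mult ess_bounded_const ess_bounded_mult)
  then show "abs_linfty f ^ n = abs_linfty (\<lambda>z. f z ^ n)" "ess_bounded (\<lambda>z. f z ^ n)" by auto
qed

lemma abs_linfty_prod:
  assumes "finite A" "\<And>i. i \<in> A \<Longrightarrow> ess_bounded (f i)"
  shows "(\<Prod>i\<in>A. abs_linfty (f i)) = abs_linfty (\<lambda>z. \<Prod>i\<in>A. f i z) \<and> ess_bounded (\<lambda>z. \<Prod>i\<in>A. f i z)"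
  using assms
  by (induction A rule: finite_induct)
    (auto simp: abs_linfty_one abs_linfty_mult ess_bounded_const ess_bounded_mult)

section \<open>Localisation at a boundary point\<close>

context douglas
begin

text \<open>With \<open>u = b * indicator E\<close> and \<open>E \<subseteq> {z. cmod (g z - a) \<le> \<eta>}\<close>, the norm of \<open>u * (g - a) ^ n\<close> is at
  most \<open>\<eta> ^ n\<close> for every \<open>n\<close>, which bounds \<open>cmod (y g - a)\<close> by \<open>\<eta>\<close> wherever \<open>y u \<noteq> 0\<close>.\<close>

lemma character_near_const:
  assumes g: "ess_bounded g" "abs_linfty g \<in> D" and u: "ess_bounded u" "abs_linfty u \<in> D"
    and u1: "AE z in circle_measure. cmod (u z) \<le> 1"
    and near: "AE z in circle_measure. u z \<noteq> 0 \<longrightarrow> cmod (g z - a) \<le> \<eta>" and "\<eta> > 0"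
    and y: "y \<in> characters D" "y (abs_linfty u) \<noteq> 0"
  shows "cmod (y (abs_linfty g) - a) \<le> \<eta>"
proof (rule ccontr)
  assume "\<not> cmod (y (abs_linfty g) - a) \<le> \<eta>"
  then have q: "cmod (y (abs_linfty g) - a) / \<eta> > 1" using \<open>\<eta> > 0\<close> by simp
  define h where "h = abs_linfty g - a *\<^sub>C 1"
  have h: "h \<in> D" unfolding h_def by (intro diff scaleC one g)
  have h_eq: "h = abs_linfty (\<lambda>z. g z - a)"
    unfolding h_def abs_linfty_one using g(1) by (simp add: abs_linfty_scaleC abs_linfty_diff ess_bounded_const)
  have ga: "ess_bounded (\<lambda>z. g z - a)" by (intro ess_bounded_diff g ess_bounded_const)
  have yh: "y h = y (abs_linfty g) - a"
    unfolding h_def using y(1) g(2) one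
    by (simp add: character_diff scaleC character_scaleC character_one)
  have bound: "cmod (y (abs_linfty u)) * cmod (y h) ^ n \<le> \<eta> ^ n" for n
  proof -
    have "cmod (y (abs_linfty u)) * cmod (y h) ^ n = cmod (y (abs_linfty u * h ^ n))"
      using y(1) u(2) h by (simp add: character_mult character_power power norm_mult norm_power)
    also have "\<dots> \<le> norm (abs_linfty u * h ^ n)"
      by (intro character_norm_le y mult u power h)
    also have "abs_linfty u * h ^ n = abs_linfty (\<lambda>z. u z * (g z - a) ^ n)"
      unfolding h_eq using abs_linfty_power[OF ga, of n] u(1) by (simp add: abs_linfty_mult)
    also have "norm \<dots> \<le> \<eta> ^ n"
    proof (rule norm_abs_linfty_le)
      show "ess_bounded (\<lambda>z. u z * (g z - a) ^ n)"
        by (intro ess_bounded_mult u abs_linfty_power ga)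
      show "AE z in circle_measure. cmod (u z * (g z - a) ^ n) \<le> \<eta> ^ n"
        using u1 near
      proof eventually_elim
        case (elim z)
        show ?case
        proof (cases "u z = 0")
          case False
          have "cmod (u z) * cmod (g z - a) ^ n \<le> 1 * \<eta> ^ n"
            using elim False by (intro mult_mono power_mono) auto
          then show ?thesis by (simp add: norm_mult norm_power)
        qed (use \<open>\<eta> > 0\<close> in simp)
      qed
    qed
    finally show ?thesis .
  qed
  obtain n where n: "1 / cmod (y (abs_linfty u)) < (cmod (y h) / \<eta>) ^ n"
    using real_arch_pow[OF q] unfolding yh by blast
  have "1 < cmod (y (abs_linfty u)) * (cmod (y h) / \<eta>) ^ n"
    using n y(2) by (simp add: divide_less_eq mult.commute)
  also have "\<dots> = cmod (y (abs_linfty u)) * cmod (y h) ^ n / \<eta> ^ n"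
    by (simp add: power_divide)
  also have "\<dots> \<le> 1" using bound[of n] \<open>\<eta> > 0\<close> by simp
  finally show False by simp
qed

text \<open>The centre \<open>a\<close> is not chosen near \<open>x g\<close>; the vanishing product
  selects it. Once \<open>x u \<noteq> 0\<close> is known, the estimate for \<open>y\<close> also
  applies to \<open>x\<close>, so both values are within \<open>\<eta> / 2\<close> of
  \<open>a\<close>.\<close>

lemma unimodular_characters_local_multiplier:
  assumes x: "x \<in> unimodular_characters" and g: "g \<in> D" and "\<eta> > 0"
  obtains u where "u \<in> D" "x u \<noteq> 0" "\<And>y. y \<in> characters D \<Longrightarrow> y u \<noteq> 0 \<Longrightarrow> cmod (y g - x g) \<le> \<eta>"
proof -
  have xc: "x \<in> characters D" using x by (simp add: unimodular_characters_def)
  obtain f where f: "ess_bounded f" "g = abs_linfty f" by (rule abs_linfty_cases)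
  note [measurable] = ess_boundedD[OF f(1)]
  have "compact (cball (0::complex) (norm g))" by (rule compact_cball)
  then have "\<exists>A. finite A \<and> cball (0::complex) (norm g) \<subseteq> (\<Union>a\<in>A. ball a (\<eta> / 2))"
    using half_gt_zero[OF \<open>\<eta> > 0\<close>] unfolding compact_eq_totally_bounded by blast
  then obtain A where A: "finite A" "cball (0::complex) (norm g) \<subseteq> (\<Union>a\<in>A. ball a (\<eta> / 2))"
    by blast
  define E where "E a = {z \<in> space circle_measure. cmod (f z - a) < \<eta> / 2}" for a
  have E: "E a \<in> sets circle_measure" for a unfolding E_def by measurable
  define Q where "Q a b \<longleftrightarrow> ess_bounded b \<and> (AE z in circle_measure. cmod (b z) = 1) \<and>
    abs_linfty b \<in> D \<and> abs_linfty (\<lambda>z. b z * indicator (E a) z) \<in> D" for a b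
  have "\<exists>b. Q a b" for a
    unfolding Q_def using indicator_multiplier[OF E[of a]] by blast
  then obtain b where "\<And>a. Q a (b a)" by metis
  then have b: "\<And>a. ess_bounded (b a)" "\<And>a. AE z in circle_measure. cmod (b a z) = 1"
    "\<And>a. abs_linfty (b a) \<in> D" "\<And>a. abs_linfty (\<lambda>z. b a z * indicator (E a) z) \<in> D"
    unfolding Q_def by blast+
  define U where "U a = abs_linfty (\<lambda>z. b a z * indicator (E a) z)" for a
  have ebU: "ess_bounded (\<lambda>z. b a z * indicator (E a) z)" for a
    by (intro ess_bounded_mult b ess_bounded_indicator E)
  have ebd: "ess_bounded (\<lambda>z. b a z - b a z * indicator (E a) z)" for a
    by (intro ess_bounded_diff b ebU)
  have U: "U a \<in> D" for a unfolding U_def by (rule b)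
  \<comment> \<open>At almost every point some \<open>E a\<close> contains \<open>z\<close>, and
    there the factor \<open>b a * (1 - indicator (E a))\<close> is 0.\<close>
  have "(\<Prod>a\<in>A. abs_linfty (b a) - U a) = (\<Prod>a\<in>A. abs_linfty (\<lambda>z. b a z - b a z * indicator (E a) z))"
    unfolding U_def by (simp add: abs_linfty_diff b ebU)
  also have "\<dots> = abs_linfty (\<lambda>z. \<Prod>a\<in>A. b a z - b a z * indicator (E a) z)"
    using abs_linfty_prod[OF A(1), of "\<lambda>a z. b a z - b a z * indicator (E a) z"] ebd by blast
  also have "\<dots> = 0"
    unfolding abs_linfty_zero
  proof (rule abs_linfty_eqI)
    show "ess_bounded (\<lambda>z. \<Prod>a\<in>A. b a z - b a z * indicator (E a) z)"
      using abs_linfty_prod[OF A(1), of "\<lambda>a z. b a z - b a z * indicator (E a) z"] ebd by blast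
    have "AE z in circle_measure. z \<in> space circle_measure" by (rule AE_space)
    then show "AE z in circle_measure. (\<Prod>a\<in>A. b a z - b a z * indicator (E a) z) = 0"
      using norm_abs_linfty_AE[OF f(1)]
    proof eventually_elim
      case (elim z)
      then have "f z \<in> cball 0 (norm g)" by (simp add: f(2))
      then obtain a where "a \<in> A" "f z \<in> ball a (\<eta> / 2)" using A(2) by blast
      then have "z \<in> E a" using elim by (simp add: E_def dist_norm norm_minus_commute)
      then have "b a z - b a z * indicator (E a) z = 0" by simp
      with \<open>a \<in> A\<close> A(1) show ?case by (intro prod_zero) blast+
    qed
  qed (rule ess_bounded_const)
  finally have "x (\<Prod>a\<in>A. abs_linfty (b a) - U a) = 0"
    using character_zero[OF xc] by simp
  then have "(\<Prod>a\<in>A. x (abs_linfty (b a) - U a)) = 0"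
    by (simp add: character_prod[OF xc] diff b U)
  then obtain a where "a \<in> A" "x (abs_linfty (b a) - U a) = 0"
    using A(1) by (auto simp: prod_zero_iff)
  then have "x (U a) = x (abs_linfty (b a))"
    by (simp add: character_diff[OF xc] b U)
  moreover have "unimodular (abs_linfty (b a))"
    unfolding unimodular_def using b by blast
  then have "cmod (x (abs_linfty (b a))) = 1"
    using x b(3) by (simp add: unimodular_characters_def)
  ultimately have xU: "x (U a) \<noteq> 0" by auto
  have near: "cmod (y g - a) \<le> \<eta> / 2" if "y \<in> characters D" "y (U a) \<noteq> 0" for y
    unfolding f(2)
  proof (rule character_near_const[OF f(1) _ ebU])
    show "AE z in circle_measure. cmod (b a z * indicator (E a) z) \<le> 1"
      using b(2)[of a] by eventually_elim (simp add: indicator_def)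
    show "AE z in circle_measure. b a z * indicator (E a) z \<noteq> 0 \<longrightarrow> cmod (f z - a) \<le> \<eta> / 2"
      by (rule AE_I2) (auto simp: E_def indicator_def)
    show "y (abs_linfty (\<lambda>z. b a z * indicator (E a) z)) \<noteq> 0" using that by (simp add: U_def)
  qed (use that g f \<open>\<eta> > 0\<close> b in auto)
  show ?thesis
  proof (rule that)
    fix y assume "y \<in> characters D" "y (U a) \<noteq> 0"
    then have "cmod (y g - a) \<le> \<eta> / 2" "cmod (x g - a) \<le> \<eta> / 2"
      using near xc xU by auto
    then show "cmod (y g - x g) \<le> \<eta>"
      using norm_triangle_ineq4[of "y g - a" "x g - a"] by simp
  qed (use U xU in auto)
qed

text \<open>A basic neighbourhood constrains finitely many coordinates \<open>i\<close>; the product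
  of local multipliers for these \<open>i\<close>, scaled to value 1 at \<open>x\<close>, vanishes
  wherever one constraint fails.\<close>

lemma unimodular_characters_regular:
  assumes x: "x \<in> unimodular_characters"
  shows "regularity_point_type_one D x"
  unfolding regularity_point_type_one_def
proof (intro conjI allI impI)
  show xc: "x \<in> characters D" using x by (simp add: unimodular_characters_def)
  fix V assume "V \<subseteq> characters D" "\<exists>U. openin (gelfand_topology D) U \<and> x \<in> U \<and> U \<subseteq> V"
  then obtain U where U: "openin (gelfand_topology D) U" "x \<in> U" "U \<subseteq> V" by blast
  obtain T where T: "openin (product_topology (\<lambda>_. euclidean) D) T" "U = T \<inter> characters D"
    using U(1) unfolding gelfand_topology_def openin_subtopology by blast
  have "x \<in> T" using U(2) T(2) by blast
  then obtain W where W: "finite {i \<in> D. W i \<noteq> UNIV}" "\<And>i. i \<in> D \<Longrightarrow> open (W i)"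
      "x \<in> Pi\<^sub>E D W" "Pi\<^sub>E D W \<subseteq> T"
    using T(1) unfolding openin_product_topology_alt by auto
  define J where "J = {i \<in> D. W i \<noteq> UNIV}"
  have J: "finite J" "J \<subseteq> D" using W(1) by (auto simp: J_def)
  \<comment> \<open>Closed balls, because the support is a closure: it stays inside the closed set
    that they define.\<close>
  have "\<exists>e>0. cball (x i) e \<subseteq> W i" if "i \<in> J" for i
    using W(2)[of i] W(3) J(2) that by (intro open_contains_cball[THEN iffD1, rule_format]) auto
  then obtain e where e: "\<And>i. i \<in> J \<Longrightarrow> e i > 0" "\<And>i. i \<in> J \<Longrightarrow> cball (x i) (e i) \<subseteq> W i"
    by metis
  define Q where "Q i u \<longleftrightarrow> u \<in> D \<and> x u \<noteq> 0 \<and>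
    (\<forall>y\<in>characters D. y u \<noteq> 0 \<longrightarrow> cmod (y i - x i) \<le> e i)" for i u
  have "\<exists>u. Q i u" if "i \<in> J" for i
  proof -
    have "i \<in> D" using J(2) that by blast
    then show ?thesis
      unfolding Q_def by (rule unimodular_characters_local_multiplier[OF x _ e(1)[OF that]]) blast
  qed
  then obtain u where "\<And>i. i \<in> J \<Longrightarrow> Q i (u i)" by metis
  then have u: "\<And>i. i \<in> J \<Longrightarrow> u i \<in> D" "\<And>i. i \<in> J \<Longrightarrow> x (u i) \<noteq> 0"
      "\<And>i y. i \<in> J \<Longrightarrow> y \<in> characters D \<Longrightarrow> y (u i) \<noteq> 0 \<Longrightarrow> cmod (y i - x i) \<le> e i"
    unfolding Q_def by blast+
  define p where "p = prod u J"
  have p: "p \<in> D" unfolding p_def using u(1) by (rule prod)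
  have yp: "y p = (\<Prod>i\<in>J. y (u i))" if "y \<in> characters D" for y
    unfolding p_def using that u(1) by (rule character_prod)
  have xp: "x p \<noteq> 0" using yp[OF xc] u(2) J(1) by simp
  define f where "f = (1 / x p) *\<^sub>C p"
  have f: "f \<in> D" unfolding f_def using p by (rule scaleC)
  have yf: "y f = y p / x p" if "y \<in> characters D" for y
    unfolding f_def using character_scaleC[OF that p] by simp
  \<comment> \<open>The intersection with \<open>characters D\<close> matters for
    \<open>J = {}\<close>, where the indexed intersection is the whole type.\<close>
  define C where "C = characters D \<inter> (\<Inter>i\<in>J. {y \<in> characters D. y i \<in> cball (x i) (e i)})"
  have C: "closedin (gelfand_topology D) C"
  proof (cases "J = {}")
    case True
    then show ?thesis
      using closedin_topspace[of "gelfand_topology D"] by (simp add: C_def)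
  next
    case False
    have "closedin (gelfand_topology D) (\<Inter>i\<in>J. {y \<in> characters D. y i \<in> cball (x i) (e i)})"
      using False J(2) by (intro closedin_INT closedin_gelfand_level) auto
    moreover have "C = (\<Inter>i\<in>J. {y \<in> characters D. y i \<in> cball (x i) (e i)})"
      using False by (auto simp: C_def)
    ultimately show ?thesis by simp
  qed
  have "{y \<in> characters D. y f \<noteq> 0} \<subseteq> C"
  proof safe
    fix y assume y: "y \<in> characters D" "y f \<noteq> 0"
    then have nz: "y (u i) \<noteq> 0" if "i \<in> J" for i
      using yf[OF y(1)] yp[OF y(1)] J(1) that by (auto simp: prod_zero_iff)
    have "y i \<in> cball (x i) (e i)" if "i \<in> J" for i
      using u(3)[OF that y(1) nz[OF that]] by (simp add: dist_norm norm_minus_commute)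
    with y(1) show "y \<in> C" by (auto simp: C_def)
  qed
  then have "gelfand_support D f \<subseteq> C"
    unfolding gelfand_support_def using C by (rule closure_of_minimal)
  also have "C \<subseteq> U"
  proof
    fix y assume y: "y \<in> C"
    then have yc: "y \<in> characters D" by (simp add: C_def)
    have "y \<in> Pi\<^sub>E D W"
    proof (rule PiE_I)
      fix i assume "i \<in> D"
      show "y i \<in> W i"
      proof (cases "i \<in> J")
        case True
        then show ?thesis using y e(2)[OF True] by (auto simp: C_def)
      next
        case False
        then show ?thesis using \<open>i \<in> D\<close> by (simp add: J_def)
      qed
    next
      \<comment> \<open>Membership in \<open>Pi\<^sub>E\<close> also prescribes the default value
        off \<open>D\<close>, which extensionality of characters provides.\<close>
      fix i assume "i \<notin> D"
      then show "y i = undefined" using yc by (auto simp: characters_def extensional_def)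
    qed
    then show "y \<in> U" using W(4) T(2) yc by blast
  qed
  finally have "gelfand_support D f \<subseteq> V" using U(3) by blast
  moreover have "x f = 1" using yf[OF xc] xp by simp
  ultimately show "\<exists>f\<in>D. x f = 1 \<and> gelfand_support D f \<subseteq> V" using f by blast
qed

text \<open>The set is a closed boundary all of whose points are regularity points, and those lie in
  every closed boundary; so the least one exists and is this set.\<close>

lemma shilov_boundary_eq_unimodular_characters: "shilov_boundary D = unimodular_characters"
  unfolding shilov_boundary_def
proof (rule Least_equality)
  show "closed_boundary D unimodular_characters" by (rule closed_boundary_unimodular_characters)
  show "unimodular_characters \<subseteq> T" if "closed_boundary D T" for T
    using regularity_point_in_closed_boundary[OF that] unimodular_characters_regular by blast
qed

end

theorem theorem3p1:
  fixes D :: "linfty set"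
  assumes "douglas_algebra D"
  shows "shilov_boundary D \<subseteq> characters D \<and>
         pointwise_regular_on D (shilov_boundary D) \<and>
         (\<forall>X. X \<subseteq> characters D \<and> pointwise_regular_on D X \<longrightarrow> X \<subseteq> shilov_boundary D)"
proof -
  interpret douglas D by unfold_locales fact
  have "unimodular_characters \<subseteq> characters D" by (auto simp: unimodular_characters_def)
  then show ?thesis
    unfolding shilov_boundary_eq_unimodular_characters pointwise_regular_on_def
    using unimodular_characters_regular regularity_point_in_closed_boundary[OF closed_boundary_unimodular_characters] by blast
qed

end
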